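(* Let $1<q<p<\infty$ and $c>0$. Then \[ \sup\Big\{\mu_{p,q}(\Omega)\ :\ \Omega\subset\mathbb{R}^N \text{ open, bounded and convex},\ \mathrm{diam}(\Omega)\ge c\Big\}=+\infty. \] A maximizing sequence is given by any family $\{\Omega_k\}_{k\in\mathbb{N}}$ of open bounded convex subsets of $\mathbb{R}^N$ such that $\mathrm{diam}(\Omega_k)=c$ for every $k$ and $\lim_{k\to\infty}|\Omega_k|=0$; i.e. for any such family, $\lim_{k\to\infty}\mu_{p,q}(\Omega_k)=+\infty$.
   Context: For an open bounded Lipschitz set $\Omega\subset\mathbb{R}^N$ and $1<q<p<\infty$, define \[ \mu_{p,q}(\Omega)=\inf_{v\in W^{1,p}(\Omega)\setminus\{0\}}\left\{\frac{\int_\Omega|\nabla v|^p\,dx}{\left(\int_\Omega|v|^q\,dx\right)^{p/q}}\ :\ \int_\Omega|v|^{q-2}v\,dx=0\right\}. \] $|\cdot|$ applied to a set denotes $N$-dimensional Lebesgue measure and $\mathrm{diam}$ denotes the diameter.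
   Formalization: The supremum claim is stated only for N ≥ 2, because for N = 1 the sets are intervals of length at least c and the supremum is finite; the limit claim for families with |Ω_k| → 0 is kept for every N ≥ 1. *)

theory Defs
  imports "HOL-Analysis.Analysis"
begin

text \<open>Functions all of whose partial derivatives up to order \<open>k\<close> exist and are continuous on
  the whole space; in the successor case differentiability of \<open>f\<close> makes the values of
  \<^const>\<open>frechet_derivative\<close> meaningful.\<close>

primrec C_k :: "nat \<Rightarrow> ('a::euclidean_space \<Rightarrow> real) \<Rightarrow> bool" where
  "C_k 0 f \<longleftrightarrow> continuous_on UNIV f"
| "C_k (Suc k) f \<longleftrightarrow>
     (\<forall>x. f differentiable (at x)) \<and>
     (\<forall>b\<in>Basis. C_k k (\<lambda>x. frechet_derivative f (at x) b))"

definition test_function :: "'a::euclidean_space set \<Rightarrow> ('a \<Rightarrow> real) \<Rightarrow> bool" where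
  "test_function \<Omega> \<phi> \<longleftrightarrow>
     (\<forall>k. C_k k \<phi>) \<and>
     compact (closure {x. \<phi> x \<noteq> 0}) \<and> closure {x. \<phi> x \<noteq> 0} \<subseteq> \<Omega>"

definition Lp :: "real \<Rightarrow> 'a::euclidean_space set \<Rightarrow> ('a \<Rightarrow> 'b::euclidean_space) set" where
  "Lp p \<Omega> = {f. f \<in> borel_measurable (lebesgue_on \<Omega>) \<and>
                integrable (lebesgue_on \<Omega>) (\<lambda>x. norm (f x) powr p)}"

definition locally_integrable ::
    "'a::euclidean_space set \<Rightarrow> ('a \<Rightarrow> 'b::euclidean_space) \<Rightarrow> bool" where
  "locally_integrable \<Omega> f \<longleftrightarrow> (\<forall>K. compact K \<and> K \<subseteq> \<Omega> \<longrightarrow> integrable (lebesgue_on K) f)"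

definition has_weak_gradient ::
    "'a::euclidean_space set \<Rightarrow> ('a \<Rightarrow> real) \<Rightarrow> ('a \<Rightarrow> 'a) \<Rightarrow> bool" where
  "has_weak_gradient \<Omega> v g \<longleftrightarrow>
     locally_integrable \<Omega> v \<and> locally_integrable \<Omega> g \<and>
     (\<forall>\<phi>. test_function \<Omega> \<phi> \<longrightarrow>
        (\<forall>b\<in>Basis.
           (LINT x|lebesgue_on \<Omega>. v x * frechet_derivative \<phi> (at x) b) =
           - (LINT x|lebesgue_on \<Omega>. (g x \<bullet> b) * \<phi> x)))"

definition W1p :: "real \<Rightarrow> 'a::euclidean_space set \<Rightarrow> ('a \<Rightarrow> real) set" where
  "W1p p \<Omega> = {v. v \<in> Lp p \<Omega> \<and> (\<exists>g. g \<in> Lp p \<Omega> \<and> has_weak_gradient \<Omega> v g)}"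

text \<open>Elements of \<^const>\<open>W1p\<close> are represented by functions rather than by classes modulo null
  sets, so being nonzero means not vanishing almost everywhere. The weak gradient \<open>g\<close> is
  determined by \<open>v\<close> up to a null set of \<open>\<Omega>\<close>, so the quotient depends on \<open>v\<close> only. The infimum
  is taken in the extended reals. At points where \<open>v\<close> vanishes,
  \<open>\<bar>v x\<bar> powr (q - 2) * v x\<close> equals \<open>0\<close>, also for \<open>q < 2\<close>.\<close>

definition mu :: "real \<Rightarrow> real \<Rightarrow> 'a::euclidean_space set \<Rightarrow> ereal" where
  "mu p q \<Omega> =
     Inf {ereal ((LINT x|lebesgue_on \<Omega>. norm (g x) powr p) /
                 (LINT x|lebesgue_on \<Omega>. \<bar>v x\<bar> powr q) powr (p / q)) | v g.
            v \<in> W1p p \<Omega> \<and> \<not> (AE x in lebesgue_on \<Omega>. v x = 0) \<and>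
            g \<in> Lp p \<Omega> \<and> has_weak_gradient \<Omega> v g \<and>
            (LINT x|lebesgue_on \<Omega>. \<bar>v x\<bar> powr (q - 2) * v x) = 0}"

end

theory Submission
  imports Defs "HOL-Computational_Algebra.Polynomial"
begin

text \<open>For convex \<open>\<Omega>\<close> of diameter at most \<open>d\<close> the bound
  \<open>mu p q \<Omega> \<ge> K powr (- p / q) * |\<Omega>| powr (1 - p / q)\<close> holds with \<open>K = 2 ^ N * d powr q\<close>. Since
  \<open>p > q\<close>, it tends to infinity as \<open>|\<Omega>|\<close> tends to 0.

  Write \<open>v (x + h) - v x\<close> as the integral of \<open>g \<bullet> h\<close> over the segment from \<open>x\<close> to \<open>x + h\<close>
  (for fixed \<open>h\<close> and almost every \<open>x\<close>, by testing the weak gradient against translated bumps).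
  Jensen's inequality and Tonelli's theorem then give
  \<open>\<integral>\<integral> |v x - v y| powr q \<le> K * |\<Omega>| * \<integral> |g| powr q\<close>. The condition on \<open>v\<close> says that
  \<open>c \<mapsto> \<integral> |v - c| powr q\<close> is minimal at \<open>c = 0\<close>; averaging over \<open>c = v y\<close> yields
  \<open>\<integral> |v| powr q \<le> K * \<integral> |g| powr q\<close>, and Jensen's inequality passes from \<open>q\<close> to \<open>p\<close>.\<close>

section \<open>Smooth bump functions on boxes\<close>

text \<open>Each unfolding of \<open>C_k\<close> passes to a partial derivative, which lies in
  \<open>S\<close> again; hence an induction on \<open>k\<close> with \<open>f\<close>
  arbitrary.\<close>

lemma C_k_of_derivative_closed:
  fixes S :: "('a::euclidean_space \<Rightarrow> real) set"
  assumes diff: "\<And>f x. f \<in> S \<Longrightarrow> f differentiable (at x)"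
    and closed: "\<And>f b. f \<in> S \<Longrightarrow> b \<in> Basis \<Longrightarrow> (\<lambda>x. frechet_derivative f (at x) b) \<in> S"
  shows "f \<in> S \<Longrightarrow> C_k k f"
proof (induction k arbitrary: f)
  case 0
  then show ?case
    using diff by (auto simp: continuous_on_eq_continuous_within intro: differentiable_imp_continuous_within)
next
  case (Suc k)
  then show ?case using diff closed by auto
qed

text \<open>The classical cutoff \<open>exp (- 1 / t)\<close>, with a polynomial factor in \<open>1 / t\<close> that makes the
  family closed under differentiation.\<close>

definition exp_cutoff :: "real poly \<Rightarrow> real \<Rightarrow> real" where
  "exp_cutoff P t = (if 0 < t then poly P (inverse t) * exp (- inverse t) else 0)"

lemma poly_times_exp_minus_tendsto_0:
  "((\<lambda>s::real. poly P s * exp (- s)) \<longlongrightarrow> 0) at_top"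
proof -
  have "((\<lambda>s::real. \<Sum>i\<le>degree P. coeff P i * (s ^ i / exp s)) \<longlongrightarrow> (\<Sum>i\<le>degree P. coeff P i * 0)) at_top"
    by (intro tendsto_sum tendsto_mult tendsto_const tendsto_power_div_exp_0)
  then show ?thesis
    by (simp add: poly_altdef exp_minus divide_inverse sum_distrib_right mult.assoc)
qed

text \<open>With \<open>s = 1 / t\<close> the chain rule gives
  \<open>s^2 * (P s - P' s) * exp (- s)\<close>, and applying \<open>pCons 0\<close> twice is
  multiplication by \<open>s^2\<close>. So only the polynomial changes, and this holds at
  \<open>t = 0\<close> as well.\<close>

lemma exp_cutoff_has_derivative:
  "(exp_cutoff P has_real_derivative exp_cutoff (pCons 0 (pCons 0 (P - pderiv P))) t) (at t)"
proof -
  consider "t > 0" | "t < 0" | "t = 0" by linarith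
  then show ?thesis
  proof cases
    case 1
    have "((\<lambda>t. poly P (inverse t) * exp (- inverse t)) has_real_derivative
        exp_cutoff (pCons 0 (pCons 0 (P - pderiv P))) t) (at t)"
      using 1 by (auto intro!: derivative_eq_intros poly_DERIV[THEN DERIV_chain2]
          simp: exp_cutoff_def algebra_simps power2_eq_square)
    moreover have "\<forall>\<^sub>F s in nhds t. exp_cutoff P s = poly P (inverse s) * exp (- inverse s)"
      using eventually_nhds_in_open[of "{0<..}" t] 1
      by (auto simp: exp_cutoff_def elim!: eventually_mono)
    ultimately show ?thesis
      by (rule DERIV_cong_ev[OF refl _ refl, THEN iffD2, rotated])
  next
    case 2
    have "((\<lambda>t. 0) has_real_derivative exp_cutoff (pCons 0 (pCons 0 (P - pderiv P))) t) (at t)"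
      using 2 by (auto simp: exp_cutoff_def)
    moreover have "\<forall>\<^sub>F s in nhds t. exp_cutoff P s = 0"
      using eventually_nhds_in_open[of "{..<0}" t] 2
      by (auto simp: exp_cutoff_def elim!: eventually_mono)
    ultimately show ?thesis
      by (rule DERIV_cong_ev[OF refl _ refl, THEN iffD2, rotated])
  next
    case 3
    \<comment> \<open>The difference quotient at 0 from the right: division by \<open>h\<close> adds
      one power of \<open>1 / h\<close>, which \<open>pCons 0 P\<close> absorbs, and the exponential
      beats every polynomial.\<close>
    have "((\<lambda>h. poly (pCons 0 P) (inverse h) * exp (- inverse h)) \<longlongrightarrow> 0) (at_right (0::real))"
      by (rule filterlim_compose[OF poly_times_exp_minus_tendsto_0 filterlim_inverse_at_top_right])
    then have "((\<lambda>h. exp_cutoff P h / h) \<longlongrightarrow> 0) (at_right 0)"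
      by (rule tendsto_cong[THEN iffD1, rotated])
         (auto simp: eventually_at_filter exp_cutoff_def field_simps)
    moreover have "((\<lambda>h. exp_cutoff P h / h) \<longlongrightarrow> 0) (at_left (0::real))"
      by (rule tendsto_eventually) (auto simp: eventually_at_filter exp_cutoff_def)
    ultimately have "((\<lambda>h. exp_cutoff P h / h) \<longlongrightarrow> 0) (at (0::real))"
      by (simp add: filterlim_split_at)
    then show ?thesis
      using 3 by (simp add: DERIV_def exp_cutoff_def)
  qed
qed

text \<open>A class that contains the bumps below and is closed under directional derivatives, so
  that one derivative computation yields smoothness of every order. Among other uses, constants
  supply the factor \<open>h \<bullet> w\<close> that the chain rule produces for
  \<open>cutoff\<close>.\<close>

inductive smooth_elementary :: "('a::euclidean_space \<Rightarrow> real) \<Rightarrow> bool" where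
  const: "smooth_elementary (\<lambda>x. r)"
| cutoff: "smooth_elementary (\<lambda>x. exp_cutoff P (x \<bullet> w + r))"
| add: "smooth_elementary f \<Longrightarrow> smooth_elementary g \<Longrightarrow> smooth_elementary (\<lambda>x. f x + g x)"
| mult: "smooth_elementary f \<Longrightarrow> smooth_elementary g \<Longrightarrow> smooth_elementary (\<lambda>x. f x * g x)"

lemma smooth_elementary_has_derivative:
  assumes "smooth_elementary f"
  shows "\<exists>D. (\<forall>x. (f has_derivative D x) (at x)) \<and> (\<forall>b. smooth_elementary (\<lambda>x. D x b))"
  using assms
proof induction
  case (const r)
  then show ?case
    by (intro exI[of _ "\<lambda>x b. 0"]) (auto intro: smooth_elementary.const)
next
  case (cutoff P w r)
  let ?P' = "pCons 0 (pCons 0 (P - pderiv P))"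
  have "((\<lambda>x. exp_cutoff P (x \<bullet> w + r)) has_derivative
      (\<lambda>h. (h \<bullet> w) * exp_cutoff ?P' (x \<bullet> w + r))) (at x)" for x :: 'a
    by (rule has_derivative_compose[OF _ exp_cutoff_has_derivative[unfolded has_field_derivative_def],
          THEN has_derivative_eq_rhs])
       (auto intro!: derivative_eq_intros)
  then show ?case
    by (intro exI[of _ "\<lambda>x h. (h \<bullet> w) * exp_cutoff ?P' (x \<bullet> w + r)"])
       (auto intro: smooth_elementary.intros)
next
  case (add f g)
  then obtain D E where D: "\<And>x. (f has_derivative D x) (at x)" "\<And>b. smooth_elementary (\<lambda>x. D x b)"
    and E: "\<And>x. (g has_derivative E x) (at x)" "\<And>b. smooth_elementary (\<lambda>x. E x b)"
    by blast
  show ?case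
    by (intro exI[of _ "\<lambda>x h. D x h + E x h"])
       (auto intro!: has_derivative_add D E smooth_elementary.intros)
next
  case (mult f g)
  then obtain D E where D: "\<And>x. (f has_derivative D x) (at x)" "\<And>b. smooth_elementary (\<lambda>x. D x b)"
    and E: "\<And>x. (g has_derivative E x) (at x)" "\<And>b. smooth_elementary (\<lambda>x. E x b)"
    by blast
  show ?case
    by (intro exI[of _ "\<lambda>x h. f x * E x h + D x h * g x"])
       (auto intro!: has_derivative_mult D E smooth_elementary.intros mult.hyps)
qed

lemma C_k_smooth_elementary:
  assumes "smooth_elementary f"
  shows "C_k k f"
proof (rule C_k_of_derivative_closed[of "Collect smooth_elementary"])
  fix f :: "'a \<Rightarrow> real" and x b :: 'a
  assume "f \<in> Collect smooth_elementary"
  then obtain D where D: "\<And>x. (f has_derivative D x) (at x)" "\<And>b. smooth_elementary (\<lambda>x. D x b)"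
    using smooth_elementary_has_derivative[of f] by auto
  show "f differentiable (at x)"
    using D(1) by (rule differentiableI)
  have "frechet_derivative f (at x) = D x" for x
    using D(1) frechet_derivative_at by metis
  then show "(\<lambda>x. frechet_derivative f (at x) b) \<in> Collect smooth_elementary"
    using D(2) by simp
qed (use assms in simp)

lemma smooth_elementary_prod:
  assumes "\<And>i. i \<in> I \<Longrightarrow> smooth_elementary (f i)"
  shows "smooth_elementary (\<lambda>x. \<Prod>i\<in>I. f i x)"
proof (cases "finite I")
  case True
  then show ?thesis
    using assms by (induction I) (auto intro: smooth_elementary.intros)
qed (auto intro: smooth_elementary.intros)

text \<open>The factor \<open>Suc n\<close> steepens the edges: as \<open>n\<close> grows,
  \<open>exp_cutoff 1 (real (Suc n) * t)\<close> tends to 1 for \<open>t > 0\<close> and stays 0 for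
  \<open>t \<le> 0\<close>. The bumps thus approximate the indicator of the open box.\<close>

definition box_bump :: "nat \<Rightarrow> 'a \<Rightarrow> 'a \<Rightarrow> 'a::euclidean_space \<Rightarrow> real" where
  "box_bump n a b x = (\<Prod>i\<in>Basis. exp_cutoff 1 (real (Suc n) * (x \<bullet> i - a \<bullet> i)) *
                                   exp_cutoff 1 (real (Suc n) * (b \<bullet> i - x \<bullet> i)))"

lemma smooth_elementary_box_bump: "smooth_elementary (box_bump n a b)"
proof -
  have "smooth_elementary (\<lambda>x::'a. exp_cutoff 1 (real (Suc n) * (x \<bullet> i - a \<bullet> i)))" for i
    using smooth_elementary.cutoff[of 1 "real (Suc n) *\<^sub>R i" "- real (Suc n) * (a \<bullet> i)"]
    by (simp add: algebra_simps)
  moreover have "smooth_elementary (\<lambda>x::'a. exp_cutoff 1 (real (Suc n) * (b \<bullet> i - x \<bullet> i)))" for i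
    using smooth_elementary.cutoff[of 1 "- real (Suc n) *\<^sub>R i" "real (Suc n) * (b \<bullet> i)"]
    by (simp add: algebra_simps)
  ultimately show ?thesis
    unfolding box_bump_def[abs_def] by (intro smooth_elementary_prod smooth_elementary.mult)
qed

lemma exp_cutoff_1_bounds: "0 \<le> exp_cutoff 1 t" "exp_cutoff 1 t \<le> 1"
  by (auto simp: exp_cutoff_def)

lemma box_bump_bounds: "0 \<le> box_bump n a b x" "box_bump n a b x \<le> 1"
  unfolding box_bump_def
  by (auto intro!: prod_nonneg prod_le_1 mult_nonneg_nonneg mult_le_one simp: exp_cutoff_1_bounds)

lemma box_bump_nonzero_imp_in_box:
  assumes "box_bump n a b x \<noteq> 0"
  shows "x \<in> box a b"
proof -
  have "exp_cutoff 1 (real (Suc n) * (x \<bullet> i - a \<bullet> i)) \<noteq> 0 \<and>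
      exp_cutoff 1 (real (Suc n) * (b \<bullet> i - x \<bullet> i)) \<noteq> 0" if "i \<in> Basis" for i
    using assms that unfolding box_bump_def by fastforce
  then show ?thesis
    unfolding mem_box exp_cutoff_def
    by (auto simp del: of_nat_Suc simp: zero_less_mult_iff) (meson+)
qed

lemma box_bump_tendsto_indicator:
  "(\<lambda>n. box_bump n a b x) \<longlonglongrightarrow> indicator (box a b) x"
proof (cases "x \<in> box a b")
  case True
  have *: "(\<lambda>n. exp_cutoff 1 (real (Suc n) * t)) \<longlonglongrightarrow> 1" if "t > 0" for t :: real
  proof -
    have "(\<lambda>n. exp (- (inverse (real (Suc n)) * inverse t))) \<longlonglongrightarrow> exp (- (0 * inverse t))"
      by (intro tendsto_intros LIMSEQ_inverse_real_of_nat)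
    then show ?thesis
      using that by (simp add: exp_cutoff_def inverse_mult_distrib zero_less_mult_iff del: of_nat_Suc)
  qed
  have "(\<lambda>n. box_bump n a b x) \<longlonglongrightarrow> (\<Prod>i\<in>(Basis::'a set). 1 * 1)"
    unfolding box_bump_def using True
    by (intro tendsto_prod tendsto_mult *) (auto simp: mem_box)
  then show ?thesis using True by simp
next
  case False
  then have "box_bump n a b x = 0" for n
    using box_bump_nonzero_imp_in_box by blast
  then show ?thesis using False by simp
qed

lemma box_bump_translate: "box_bump n a b (x - d) = box_bump n (a + d) (b + d) x"
  by (simp add: box_bump_def inner_diff_left inner_add_left algebra_simps)

text \<open>The bump vanishes off the open box, so its support, being a closure, is only known to
  lie in the closed one. This is why later conditions concern \<open>cbox a b\<close>.\<close>

lemma test_function_box_bump: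
  assumes "cbox a b \<subseteq> U"
  shows "test_function U (box_bump n a b)"
proof -
  have "{x. box_bump n a b x \<noteq> 0} \<subseteq> cbox a b"
    using box_bump_nonzero_imp_in_box box_subset_cbox by blast
  then have "closure {x. box_bump n a b x \<noteq> 0} \<subseteq> cbox a b"
    by (intro closure_minimal) auto
  moreover from this have "compact (closure {x. box_bump n a b x \<noteq> 0})"
    by (meson bounded_cbox bounded_subset closed_closure compact_eq_bounded_closed)
  ultimately show ?thesis
    using assms C_k_smooth_elementary[OF smooth_elementary_box_bump]
    by (auto simp: test_function_def)
qed

section \<open>Convexity of powers and Jensen's inequality\<close>

text \<open>The convex function \<open>\<bar>s\<bar> powr q\<close> lies above its tangent at
  \<open>t\<close>. Second derivatives, singular at 0 for \<open>q < 2\<close>, are avoided: with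
  \<open>u\<close> the slope divided by \<open>q\<close>, Young's inequality for the exponents
  \<open>q\<close> and \<open>q / (q - 1)\<close> bounds \<open>u * s\<close>, and the conjugate
  power of \<open>\<bar>u\<bar>\<close> is exactly \<open>\<bar>t\<bar> powr q\<close>.\<close>

lemma powr_tangent_inequality:
  fixes s t q :: real
  assumes "1 < q"
  shows "\<bar>t\<bar> powr q + q * (\<bar>t\<bar> powr (q - 2) * t) * (s - t) \<le> \<bar>s\<bar> powr q"
proof (cases "t = 0")
  case False
  define u where "u = \<bar>t\<bar> powr (q - 2) * t"
  have ut: "u * t = \<bar>t\<bar> powr q"
  proof -
    have "\<bar>t\<bar> powr q = \<bar>t\<bar> powr ((q - 2) + 2)" by simp
    also have "\<dots> = \<bar>t\<bar> powr (q - 2) * \<bar>t\<bar> powr 2" by (rule powr_add)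
    finally show ?thesis using False by (simp add: u_def power2_eq_square)
  qed
  have abs_u: "\<bar>u\<bar> = \<bar>t\<bar> powr (q - 1)"
  proof -
    have "\<bar>t\<bar> powr (q - 1) = \<bar>t\<bar> powr ((q - 2) + 1)" by simp
    also have "\<dots> = \<bar>t\<bar> powr (q - 2) * \<bar>t\<bar> powr 1" by (rule powr_add)
    finally show ?thesis using False by (simp add: u_def abs_mult)
  qed
  have conj: "1 / q + 1 / (q / (q - 1)) = 1" "1 < q / (q - 1)"
    using assms by (auto simp: field_simps)
  have "u * s \<le> \<bar>s\<bar> * \<bar>u\<bar>"
    by (metis abs_ge_self abs_mult mult.commute)
  also have "\<dots> \<le> \<bar>s\<bar> powr q / q + \<bar>u\<bar> powr (q / (q - 1)) / (q / (q - 1))"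
    by (rule Youngs_inequality) (use assms conj in auto)
  also have "\<bar>u\<bar> powr (q / (q - 1)) = \<bar>t\<bar> powr q"
    using assms by (simp add: abs_u powr_powr)
  finally have "q * (u * s) \<le> q * (\<bar>s\<bar> powr q / q + \<bar>t\<bar> powr q / (q / (q - 1)))"
    using assms by (intro mult_left_mono) auto
  also have "\<dots> = \<bar>s\<bar> powr q + (q - 1) * \<bar>t\<bar> powr q"
    using assms by (simp add: field_simps)
  finally have "q * (u * s) \<le> \<bar>s\<bar> powr q + (q - 1) * \<bar>t\<bar> powr q" .
  moreover have "\<bar>t\<bar> powr q + q * (\<bar>t\<bar> powr (q - 2) * t) * (s - t) = \<bar>t\<bar> powr q + q * (u * s) - q * (u * t)"
    by (simp add: u_def algebra_simps)
  moreover have "q * (u * t) = q * \<bar>t\<bar> powr q" by (simp only: ut)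
  moreover have "(q - 1) * \<bar>t\<bar> powr q = q * \<bar>t\<bar> powr q - \<bar>t\<bar> powr q" by (simp add: left_diff_distrib)
  ultimately show ?thesis by linarith
qed auto

lemma powr_le_one_plus_powr:
  fixes x a b :: real
  assumes "0 \<le> x" "0 \<le> a" "a \<le> b"
  shows "x powr a \<le> 1 + x powr b"
proof (cases "x \<le> 1")
  case True
  then have "x powr a \<le> 1" using assms by (simp add: powr_le1)
  then show ?thesis by (smt (verit) powr_ge_zero)
next
  case False
  then have "x powr a \<le> x powr b" using assms by (intro powr_mono) auto
  then show ?thesis by simp
qed

text \<open>The larger power dominates where \<open>\<bar>f x\<bar> > 1\<close>; elsewhere the
  constant 1 does, and it is integrable because the measure is finite.\<close>

lemma (in finite_measure) integrable_powr_mono: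
  fixes f :: "'a \<Rightarrow> real"
  assumes [measurable]: "f \<in> borel_measurable M"
    and "integrable M (\<lambda>x. \<bar>f x\<bar> powr b)" "0 \<le> a" "a \<le> b"
  shows "integrable M (\<lambda>x. \<bar>f x\<bar> powr a)"
proof (rule Bochner_Integration.integrable_bound)
  show "integrable M (\<lambda>x. 1 + \<bar>f x\<bar> powr b)"
    using assms by simp
  have "\<bar>f x\<bar> powr a \<le> 1 + \<bar>f x\<bar> powr b" for x
    using assms by (intro powr_le_one_plus_powr) auto
  then show "AE x in M. norm (\<bar>f x\<bar> powr a) \<le> norm (1 + \<bar>f x\<bar> powr b)"
    by (auto intro!: AE_I2)
qed simp

text \<open>Jensen's inequality without normalising the measure: the tangent inequality is
  integrated at the mean value \<open>t\<close> of \<open>f\<close>, for which the linear term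
  contributes 0. Undoing the division by the total mass leaves its power
  \<open>r - 1\<close>.\<close>

lemma (in finite_measure) powr_integral_le:
  fixes f :: "'a \<Rightarrow> real"
  assumes [measurable]: "integrable M f" and f_powr: "integrable M (\<lambda>x. \<bar>f x\<bar> powr r)" and "1 < r"
  shows "\<bar>\<integral>x. f x \<partial>M\<bar> powr r \<le> measure M (space M) powr (r - 1) * (\<integral>x. \<bar>f x\<bar> powr r \<partial>M)"
proof (cases "measure M (space M) = 0")
  case True
  have "AE x in M. f x = 0"
    using True by (intro AE_I[of _ _ "space M"]) (auto simp: emeasure_eq_measure)
  then have "(\<integral>x. f x \<partial>M) = 0"
    by (rule integral_eq_zero_AE)
  then show ?thesis by simp
next
  case False
  define m where "m = measure M (space M)"
  have m: "m > 0" using False by (simp add: m_def zero_less_measure_iff)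
  define t where "t = (\<integral>x. f x \<partial>M) / m"
  have "(\<integral>x. \<bar>t\<bar> powr r + r * (\<bar>t\<bar> powr (r - 2) * t) * (f x - t) \<partial>M) \<le> (\<integral>x. \<bar>f x\<bar> powr r \<partial>M)"
    by (intro integral_mono powr_tangent_inequality) (use assms in auto)
  also have "(\<integral>x. \<bar>t\<bar> powr r + r * (\<bar>t\<bar> powr (r - 2) * t) * (f x - t) \<partial>M) = m * \<bar>t\<bar> powr r"
    using assms m by (simp add: t_def m_def[symmetric])
  finally have *: "m * \<bar>t\<bar> powr r \<le> (\<integral>x. \<bar>f x\<bar> powr r \<partial>M)" .
  have "\<bar>\<integral>x. f x \<partial>M\<bar> powr r = (m * \<bar>t\<bar>) powr r"
    using m by (simp add: t_def)
  also have "\<dots> = m powr ((r - 1) + 1) * \<bar>t\<bar> powr r"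
    using m by (simp add: powr_mult)
  also have "\<dots> = m powr (r - 1) * (m * \<bar>t\<bar> powr r)"
    using m by (subst powr_add) simp
  also have "\<dots> \<le> m powr (r - 1) * (\<integral>x. \<bar>f x\<bar> powr r \<partial>M)"
    using * by (intro mult_left_mono) auto
  finally show ?thesis by (simp add: m_def)
qed

section \<open>Functions whose integrals over boxes vanish\<close>

text \<open>Open boxes form an intersection-stable generator of the Borel sets. After cutting
  \<open>F\<close> off outside one box, Dynkin's argument makes its integral over every Borel set 0,
  so it vanishes almost everywhere on that box. Countably many boxes cover \<open>U\<close>.\<close>

lemma AE_zero_if_integral_boxes_zero:
  fixes F :: "'a::euclidean_space \<Rightarrow> real"
  assumes F: "integrable lborel F" and "open U"
    and zero: "\<And>a b. cbox a b \<subseteq> U \<Longrightarrow> (\<integral>x. indicator (box a b) x * F x \<partial>lborel) = 0"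
  shows "AE x in lborel. x \<in> U \<longrightarrow> F x = 0"
proof -
  have box_zero: "AE x in lborel. x \<in> box a b \<longrightarrow> F x = 0" if ab: "cbox a b \<subseteq> U" for a b
  proof -
    define F' where "F' x = indicator (box a b) x * F x" for x
    have F': "integrable lborel F'"
      unfolding F'_def using integrable_mult_indicator[OF _ F, of "box a b"] by simp
    have F'_set: "set_integrable lborel A F'" if "A \<in> sets borel" for A
      using that F' unfolding set_integrable_def by (intro integrable_mult_indicator) auto
    have *: "set_lebesgue_integral lborel (box c d) F' = 0" for c d
    proof (cases "box c d \<inter> box a b = {}")
      case True
      then have "indicator (box c d) x *\<^sub>R F' x = 0" for x
        by (auto simp: F'_def indicator_def)
      then show ?thesis by (simp only: set_lebesgue_integral_def integral_zero)
    next
      case False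
      obtain c' d' where cd: "box c d \<inter> box a b = box c' d'"
        using box_Int_box by blast
      \<comment> \<open>The hypothesis \<open>zero\<close> asks for the closed box to lie in
        \<open>U\<close>. As the closure of a nonempty open box inside \<open>box a b\<close>, it
        stays within \<open>cbox a b\<close>.\<close>
      have "cbox c' d' = closure (box c' d')"
        using False cd by (simp add: closure_box)
      also have "\<dots> \<subseteq> cbox a b"
        using cd box_subset_cbox by (intro closure_minimal) auto
      finally have "(\<integral>x. indicator (box c' d') x * F x \<partial>lborel) = 0"
        using ab by (intro zero) auto
      moreover have "indicator (box c d) x *\<^sub>R F' x = indicator (box c' d') x * F x" for x
        unfolding cd[symmetric] by (auto simp: F'_def indicator_def)
      ultimately show ?thesis by (simp only: set_lebesgue_integral_def)
    qed
    have "A \<in> sigma_sets UNIV (range (\<lambda>(a, b). box a b :: 'a set)) \<Longrightarrow>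
        set_lebesgue_integral lborel A F' = 0" for A
    proof (induction A rule: sigma_sets_induct_disjoint[consumes 0, rotated 2, consumes 1])
      show "Int_stable (range (\<lambda>(a, b). box a b :: 'a set))"
        by (auto simp: Int_stable_def box_Int_box)
    next
      fix A assume "A \<in> range (\<lambda>(a, b). box a b :: 'a set)"
      then show "set_lebesgue_integral lborel A F' = 0" using * by auto
    next
      fix A assume A: "A \<in> sigma_sets UNIV (range (\<lambda>(a, b). box a b :: 'a set))"
        and "set_lebesgue_integral lborel A F' = 0"
      moreover have "set_lebesgue_integral lborel UNIV F' = 0"
        using zero[OF ab] by (simp add: set_lebesgue_integral_def F'_def)
      moreover have "A \<in> sets borel" using A by (simp add: borel_eq_box)
      moreover have "set_lebesgue_integral lborel (A \<union> (UNIV - A)) F' =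
          set_lebesgue_integral lborel A F' + set_lebesgue_integral lborel (UNIV - A) F'"
        using \<open>A \<in> sets borel\<close> by (intro set_integral_Un F'_set) auto
      ultimately show "set_lebesgue_integral lborel (UNIV - A) F' = 0" by simp
    next
      fix A :: "nat \<Rightarrow> 'a set"
      assume A: "disjoint_family A" "range A \<subseteq> sigma_sets UNIV (range (\<lambda>(a, b). box a b))"
        and IH: "\<And>i. set_lebesgue_integral lborel (A i) F' = 0"
      have "A i \<in> sets borel" for i using A by (auto simp: borel_eq_box)
      then have "set_lebesgue_integral lborel (\<Union>i. A i) F' = (\<Sum>i. set_lebesgue_integral lborel (A i) F')"
        using A by (intro lebesgue_integral_countable_add F'_set) (auto simp: disjoint_family_on_def)
      then show "set_lebesgue_integral lborel (\<Union>i. A i) F' = 0" using IH by simp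
    qed (auto simp: set_lebesgue_integral_def)
    then have "AE x in lborel. F' x = 0"
      using F' by (intro sigma_finite_measure.density_zero[OF sigma_finite_lborel]) (auto simp: borel_eq_box)
    then show ?thesis by eventually_elim (auto simp: F'_def)
  qed
  obtain \<D> where \<D>: "countable \<D>" "\<D> \<subseteq> Pow U"
      "\<And>X. X \<in> \<D> \<Longrightarrow> \<exists>a b. X = cbox a b" "\<Union>\<D> = U"
    using open_countable_Union_open_cbox[OF \<open>open U\<close>] by metis
  have "AE x in lborel. x \<in> X \<longrightarrow> F x = 0" if "X \<in> \<D>" for X
  proof -
    obtain a b where X: "X = cbox a b" using \<D>(3) \<open>X \<in> \<D>\<close> by blast
    \<comment> \<open>The cover consists of closed boxes while \<open>box_zero\<close> concerns open
      ones; the faces are null sets.\<close>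
    have "AE x in lborel. x \<notin> cbox a b - box a b"
      using negligible_frontier_interval[of a b]
      by (intro AE_not_in) (simp add: negligible_iff_null_sets null_sets_completion_iff)
    moreover have "AE x in lborel. x \<in> box a b \<longrightarrow> F x = 0"
      using X \<D>(2) that by (intro box_zero) auto
    ultimately show ?thesis unfolding X by eventually_elim auto
  qed
  then have "AE x in lborel. \<forall>X\<in>\<D>. x \<in> X \<longrightarrow> F x = 0"
    by (intro AE_ball_countable[OF \<D>(1), THEN iffD2] ballI)
  then show ?thesis by eventually_elim (use \<D>(4) in blast)
qed

section \<open>Affine substitutions and the uniform measure on the unit interval\<close>

lemma nn_integral_lborel_affine:
  fixes f :: "'a::euclidean_space \<Rightarrow> ennreal"
  assumes [measurable]: "f \<in> borel_measurable borel" and "s \<noteq> 0"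
  shows "(\<integral>\<^sup>+x. f x \<partial>lborel) = ennreal (\<bar>s\<bar> ^ DIM('a)) * (\<integral>\<^sup>+h. f (y + s *\<^sub>R h) \<partial>lborel)"
  by (subst lborel_affine[OF \<open>s \<noteq> 0\<close>, of y])
     (simp add: nn_integral_density nn_integral_distr nn_integral_cmult)

text \<open>The Jacobian \<open>\<bar>s\<bar> ^ DIM('a)\<close> is at least
  \<open>1 / 2 ^ DIM('a)\<close>. This is the origin of the power of 2 in the final
  constant.\<close>

lemma nn_integral_lborel_affine_le:
  fixes f :: "'a::euclidean_space \<Rightarrow> ennreal"
  assumes [measurable]: "f \<in> borel_measurable borel" and "1 / 2 \<le> \<bar>s\<bar>"
  shows "(\<integral>\<^sup>+h. f (y + s *\<^sub>R h) \<partial>lborel) \<le> ennreal (2 ^ DIM('a)) * (\<integral>\<^sup>+x. f x \<partial>lborel)"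
proof -
  have "1 \<le> (2 * \<bar>s\<bar>) ^ DIM('a)"
    using assms by (intro one_le_power) auto
  then have "(\<integral>\<^sup>+h. f (y + s *\<^sub>R h) \<partial>lborel) \<le>
      ennreal ((2 * \<bar>s\<bar>) ^ DIM('a)) * (\<integral>\<^sup>+h. f (y + s *\<^sub>R h) \<partial>lborel)"
    by (metis ennreal_1 ennreal_leI mult_1 mult_right_mono zero_le)
  also have "\<dots> = ennreal (2 ^ DIM('a)) * (\<integral>\<^sup>+x. f x \<partial>lborel)"
    using assms
    by (subst nn_integral_lborel_affine[of f s y]) (auto simp: power_mult_distrib ennreal_mult' mult.assoc)
  finally show ?thesis .
qed

lemma nn_integral_lborel_translate:
  fixes f :: "'a::euclidean_space \<Rightarrow> ennreal"
  assumes "f \<in> borel_measurable borel"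
  shows "(\<integral>\<^sup>+h. f (y + h) \<partial>lborel) = (\<integral>\<^sup>+x. f x \<partial>lborel)"
  using nn_integral_lborel_affine[OF assms, of 1 y] by simp

text \<open>A density on the whole line rather than a restricted space: the sigma-algebra remains
  \<open>borel\<close>, which keeps measurability on products simple. In exchange,
  \<open>0 \<le> t \<le> 1\<close> holds only almost everywhere.\<close>

definition unit_interval_measure :: "real measure" where
  "unit_interval_measure = density lborel (\<lambda>t. ennreal (indicator {0..1} t))"

lemma sets_unit_interval_measure [measurable_cong, simp]:
  "sets unit_interval_measure = sets borel"
  by (simp add: unit_interval_measure_def)

lemma space_unit_interval_measure [simp]: "space unit_interval_measure = UNIV"
  by (simp add: unit_interval_measure_def)

lemma emeasure_unit_interval_measure_UNIV: "emeasure unit_interval_measure UNIV = 1"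
  by (simp add: unit_interval_measure_def emeasure_density ennreal_indicator)

lemma measure_unit_interval_measure_UNIV [simp]: "measure unit_interval_measure UNIV = 1"
  by (simp add: measure_def emeasure_unit_interval_measure_UNIV)

interpretation unit_interval: finite_measure unit_interval_measure
  by standard (simp add: emeasure_unit_interval_measure_UNIV)

interpretation lborel_unit_interval: pair_sigma_finite "lborel :: 'a::euclidean_space measure" unit_interval_measure
  by standard

lemma AE_unit_interval_measure: "AE t in unit_interval_measure. 0 \<le> t \<and> t \<le> 1"
  unfolding unit_interval_measure_def by (subst AE_density) (auto simp: indicator_def)

lemma integral_unit_interval_measure_derivative:
  fixes F f :: "real \<Rightarrow> real"
  assumes "\<And>t. (F has_real_derivative f t) (at t)" and "continuous_on UNIV f"
  shows "(\<integral>t. f t \<partial>unit_interval_measure) = F 1 - F 0"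
proof -
  have [measurable]: "f \<in> borel_measurable borel"
    using assms(2) by (rule borel_measurable_continuous_onI)
  have "(\<integral>t. f t * indicator {0..1} t \<partial>lborel) = F 1 - F 0"
    by (rule integral_FTC_Icc_real) (use assms in \<open>auto simp: continuous_on_eq_continuous_at\<close>)
  moreover have "(\<integral>t. f t \<partial>unit_interval_measure) = (\<integral>t. indicator {0..1} t *\<^sub>R f t \<partial>lborel)"
    unfolding unit_interval_measure_def by (rule integral_density) auto
  ultimately show ?thesis
    by (simp add: mult.commute)
qed

section \<open>Differences as integrals of the weak gradient along segments\<close>

text \<open>By Tonelli, the finite mass of \<open>M2\<close> turns a dominating function of the
  first coordinate alone into a finite double integral, as Fubini's theorem requires.\<close>

lemma (in pair_sigma_finite) integrable_pair_bounded_fst: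
  fixes f :: "'a \<times> 'b \<Rightarrow> real"
  assumes [measurable]: "f \<in> borel_measurable (M1 \<Otimes>\<^sub>M M2)" and g: "integrable M1 g"
    and "finite_measure M2" and le: "\<And>x y. norm (f (x, y)) \<le> g x"
  shows "integrable (M1 \<Otimes>\<^sub>M M2) f"
proof (rule integrableI_bounded)
  interpret M2: finite_measure M2 by fact
  have "(\<integral>\<^sup>+z. norm (f z) \<partial>(M1 \<Otimes>\<^sub>M M2)) = (\<integral>\<^sup>+x. \<integral>\<^sup>+y. norm (f (x, y)) \<partial>M2 \<partial>M1)"
    by (rule M2.nn_integral_fst[symmetric]) simp
  also have "\<dots> \<le> (\<integral>\<^sup>+x. \<integral>\<^sup>+y. ennreal (g x) \<partial>M2 \<partial>M1)"
    by (intro nn_integral_mono ennreal_leI le)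
  also have "\<dots> = (\<integral>\<^sup>+x. ennreal (g x) \<partial>M1) * emeasure M2 (space M2)"
    using g by (simp add: nn_integral_multc)
  also have "\<dots> < \<infinity>"
  proof -
    have "(\<integral>\<^sup>+x. ennreal (g x) \<partial>M1) \<le> (\<integral>\<^sup>+x. ennreal (norm (g x)) \<partial>M1)"
      by (intro nn_integral_mono ennreal_leI) auto
    also have "\<dots> < \<infinity>"
      using g by (simp add: integrable_iff_bounded)
    finally show ?thesis
      by (simp add: ennreal_mult_eq_top_iff less_top[symmetric])
  qed
  finally show "(\<integral>\<^sup>+z. norm (f z) \<partial>(M1 \<Otimes>\<^sub>M M2)) < \<infinity>" .
qed simp

lemma smooth_elementary_C1:
  assumes "smooth_elementary f"
  obtains D where "\<And>x. (f has_derivative D x) (at x)" "\<And>b. continuous_on UNIV (\<lambda>x. D x b)"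
proof -
  have cont: "continuous_on UNIV g" if "smooth_elementary g" for g :: "'a \<Rightarrow> real"
    using C_k_smooth_elementary[OF that, of 0] by simp
  show ?thesis
    using smooth_elementary_has_derivative[OF assms] cont that by metis
qed

lemma integrable_lborel_translate:
  fixes f :: "'a::euclidean_space \<Rightarrow> 'b::{banach, second_countable_topology}"
  assumes "integrable lborel f"
  shows "integrable lborel (\<lambda>x. f (x + d))"
proof -
  have "integrable (distr lborel borel ((+) d)) f"
    using assms by (simp add: lborel_distr_plus)
  then show ?thesis
    using assms by (subst (asm) integrable_distr_eq) (auto simp: add.commute)
qed

lemma integral_lborel_translate:
  fixes f :: "'a::euclidean_space \<Rightarrow> 'b::{banach, second_countable_topology}"
  assumes [measurable]: "f \<in> borel_measurable borel"
  shows "(\<integral>x. f (x + d) \<partial>lborel) = (\<integral>x. f x \<partial>lborel)"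
  by (subst (2) lborel_distr_plus[of d, symmetric]) (simp add: integral_distr add.commute)

text \<open>Tonelli with \<open>x\<close> innermost: for each \<open>t\<close>, translation
  invariance removes the shift \<open>t *\<^sub>R h\<close>, so the inner integral does not depend
  on \<open>t\<close>.\<close>

lemma integrable_along_segments:
  fixes G :: "'a::euclidean_space \<Rightarrow> 'a"
  assumes G: "integrable lborel G"
  shows "integrable (lborel \<Otimes>\<^sub>M unit_interval_measure) (\<lambda>(x, t). G (x + t *\<^sub>R h) \<bullet> h)"
proof (rule integrableI_bounded)
  have [measurable]: "G \<in> borel_measurable borel" using G by auto
  show meas: "(\<lambda>(x, t). G (x + t *\<^sub>R h) \<bullet> h) \<in> borel_measurable (lborel \<Otimes>\<^sub>M unit_interval_measure)"
    by measurable
  have "(\<integral>\<^sup>+z. ennreal (norm (case z of (x, t) \<Rightarrow> G (x + t *\<^sub>R h) \<bullet> h)) \<partial>(lborel \<Otimes>\<^sub>M unit_interval_measure)) =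
      (\<integral>\<^sup>+t. \<integral>\<^sup>+x. ennreal \<bar>G (x + t *\<^sub>R h) \<bullet> h\<bar> \<partial>lborel \<partial>unit_interval_measure)"
    by (subst lborel_unit_interval.nn_integral_snd[symmetric]) auto
  also have "\<dots> = (\<integral>\<^sup>+t. \<integral>\<^sup>+x. ennreal \<bar>G x \<bullet> h\<bar> \<partial>lborel \<partial>unit_interval_measure)"
  proof -
    have "(\<integral>\<^sup>+x. ennreal \<bar>G (x + t *\<^sub>R h) \<bullet> h\<bar> \<partial>lborel) = (\<integral>\<^sup>+x. ennreal \<bar>G x \<bullet> h\<bar> \<partial>lborel)" for t
      using nn_integral_lborel_translate[of "\<lambda>x. ennreal \<bar>G x \<bullet> h\<bar>" "t *\<^sub>R h"]
      by (simp add: add.commute)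
    then show ?thesis by simp
  qed
  also have "\<dots> = (\<integral>\<^sup>+x. ennreal \<bar>G x \<bullet> h\<bar> \<partial>lborel)"
    by (simp add: emeasure_unit_interval_measure_UNIV)
  also have "\<dots> < \<infinity>"
    using integrable_inner_left[OF G, of h] by (simp add: integrable_iff_bounded)
  finally show "(\<integral>\<^sup>+z. ennreal (norm (case z of (x, t) \<Rightarrow> G (x + t *\<^sub>R h) \<bullet> h))
      \<partial>(lborel \<Otimes>\<^sub>M unit_interval_measure)) < \<infinity>" .
qed

text \<open>The weak identity is given for basis directions only; linearity in the direction extends
  it to \<open>h\<close>. The bounds on \<open>D\<close> and \<open>\<phi>\<close> make every
  summand integrable, so that sum and integral may be exchanged.\<close>

lemma integral_direction_derivative:
  fixes V :: "'a::euclidean_space \<Rightarrow> real" and G :: "'a \<Rightarrow> 'a"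
  assumes V: "integrable lborel V" and G: "integrable lborel G"
    and deriv: "\<And>x. (\<phi> has_derivative D x) (at x)"
    and cont: "\<And>b. continuous_on UNIV (\<lambda>x. D x b)"
    and bound: "\<And>x b. b \<in> Basis \<Longrightarrow> \<bar>D x b\<bar> \<le> C" "\<And>x. \<bar>\<phi> x\<bar> \<le> 1"
    and weak: "\<And>b. b \<in> Basis \<Longrightarrow> (\<integral>x. V x * D x b \<partial>lborel) = - (\<integral>x. (G x \<bullet> b) * \<phi> x \<partial>lborel)"
  shows "(\<integral>x. V x * D x h \<partial>lborel) = - (\<integral>x. (G x \<bullet> h) * \<phi> x \<partial>lborel)"
proof -
  have [measurable]: "V \<in> borel_measurable borel" "G \<in> borel_measurable borel"
    using V G by auto
  have [measurable]: "(\<lambda>x. D x b) \<in> borel_measurable borel" for b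
    using cont by (rule borel_measurable_continuous_onI)
  have "continuous_on UNIV \<phi>"
    using deriv by (auto simp: continuous_on_eq_continuous_at intro: has_derivative_continuous)
  then have [measurable]: "\<phi> \<in> borel_measurable borel"
    by (rule borel_measurable_continuous_onI)
  have lin: "D x h = (\<Sum>b\<in>Basis. (h \<bullet> b) * D x b)" for x
  proof -
    interpret D: bounded_linear "D x" using deriv by (rule has_derivative_bounded_linear)
    have "D x h = D x (\<Sum>b\<in>Basis. (h \<bullet> b) *\<^sub>R b)" by (simp add: euclidean_representation)
    then show ?thesis by (simp add: D.sum D.scale)
  qed
  have VD: "integrable lborel (\<lambda>x. V x * D x b)" if "b \<in> Basis" for b
  proof (rule Bochner_Integration.integrable_bound)
    show "integrable lborel (\<lambda>x. C * V x)" using V by simp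
    have "\<bar>V x\<bar> * \<bar>D x b\<bar> \<le> \<bar>V x\<bar> * \<bar>C\<bar>" for x
      using bound(1)[OF that, of x] by (intro mult_left_mono) auto
    then show "AE x in lborel. norm (V x * D x b) \<le> norm (C * V x)"
      by (simp add: abs_mult mult.commute)
  qed measurable
  have Gp: "integrable lborel (\<lambda>x. (G x \<bullet> b) * \<phi> x)" for b
  proof (rule Bochner_Integration.integrable_bound)
    show "integrable lborel (\<lambda>x. G x \<bullet> b)" using G by simp
    have "\<bar>G x \<bullet> b\<bar> * \<bar>\<phi> x\<bar> \<le> \<bar>G x \<bullet> b\<bar> * 1" for x
      using bound(2) by (intro mult_left_mono) auto
    then show "AE x in lborel. norm ((G x \<bullet> b) * \<phi> x) \<le> norm (G x \<bullet> b)"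
      by (simp add: abs_mult)
  qed measurable
  have "(\<integral>x. V x * D x h \<partial>lborel) = (\<integral>x. (\<Sum>b\<in>Basis. (h \<bullet> b) * (V x * D x b)) \<partial>lborel)"
    by (simp add: lin sum_distrib_left mult_ac)
  also have "\<dots> = (\<Sum>b\<in>Basis. (h \<bullet> b) * (\<integral>x. V x * D x b \<partial>lborel))"
    using VD by (subst Bochner_Integration.integral_sum) auto
  also have "\<dots> = - (\<Sum>b\<in>Basis. (h \<bullet> b) * (\<integral>x. (G x \<bullet> b) * \<phi> x \<partial>lborel))"
    using weak by (simp add: sum_negf)
  also have "(\<Sum>b\<in>Basis. (h \<bullet> b) * (\<integral>x. (G x \<bullet> b) * \<phi> x \<partial>lborel)) =
      (\<integral>x. (\<Sum>b\<in>Basis. (h \<bullet> b) * ((G x \<bullet> b) * \<phi> x)) \<partial>lborel)"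
    using Gp by (subst Bochner_Integration.integral_sum) auto
  also have "\<dots> = (\<integral>x. (G x \<bullet> h) * \<phi> x \<partial>lborel)"
  proof -
    have "(\<Sum>b\<in>Basis. (h \<bullet> b) * ((G x \<bullet> b) * \<phi> x)) = (G x \<bullet> h) * \<phi> x" for x
      by (simp add: euclidean_inner[of "G x" h] sum_distrib_left mult_ac)
    then show ?thesis by simp
  qed
  finally show ?thesis .
qed

text \<open>The bump is constantly 0 near each point outside the closed box, so its derivative
  vanishes there; on the compact box the derivative is continuous, hence bounded.\<close>

lemma box_bump_C1:
  fixes a b :: "'a::euclidean_space"
  obtains D C where "\<And>x. (box_bump n a b has_derivative D x) (at x)"
    "\<And>h. continuous_on UNIV (\<lambda>x. D x h)" "\<And>x h. \<bar>D x h\<bar> \<le> C h"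
proof -
  obtain D where D: "\<And>x. (box_bump n a b has_derivative D x) (at x)"
    "\<And>h. continuous_on UNIV (\<lambda>x. D x h)"
    using smooth_elementary_C1[OF smooth_elementary_box_bump] by metis
  have zero: "D x h = 0" if "x \<notin> cbox a b" for x h
  proof -
    have "\<forall>\<^sub>F y in nhds x. y \<in> - cbox a b"
      using that by (intro eventually_nhds_in_open) auto
    then have "\<forall>\<^sub>F y in at x. 0 = box_bump n a b y"
      unfolding eventually_at_filter
      by eventually_elim (use box_bump_nonzero_imp_in_box box_subset_cbox in force)
    then have "(box_bump n a b has_derivative (\<lambda>h. 0)) (at x)"
      by (rule has_derivative_transform_eventually[OF has_derivative_const])
         (use that box_bump_nonzero_imp_in_box box_subset_cbox in force)+
    then have "D x = (\<lambda>h. 0)" using D(1) has_derivative_unique by blast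
    then show ?thesis by simp
  qed
  have "\<exists>C. \<forall>x. \<bar>D x h\<bar> \<le> C" for h
  proof -
    have "compact ((\<lambda>x. D x h) ` cbox a b)"
      by (intro compact_continuous_image continuous_on_subset[OF D(2)]) auto
    then obtain C where "\<And>x. x \<in> cbox a b \<Longrightarrow> \<bar>D x h\<bar> \<le> C"
      using compact_imp_bounded bounded_iff by (metis imageI real_norm_def)
    then have "\<bar>D x h\<bar> \<le> max C 0" for x using zero[of x h] by (cases "x \<in> cbox a b") force+
    then show ?thesis by blast
  qed
  then obtain C where "\<And>x h. \<bar>D x h\<bar> \<le> C h" by metis
  then show ?thesis using D that by blast
qed

text \<open>A substitution moves the difference from \<open>V\<close> to the bump
  \<open>\<phi>\<close>, and \<open>\<phi> (z - h) - \<phi> z\<close> is minus the integral of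
  \<open>D (z - t *\<^sub>R h) h\<close> over \<open>t\<close>. After Fubini, each \<open>t\<close>
  contributes a derivative of a translated bump, to which the weak identity applies; translating
  back puts \<open>G\<close> at \<open>x + t *\<^sub>R h\<close>.\<close>

lemma weak_gradient_difference_integral_bump:
  fixes V :: "'a::euclidean_space \<Rightarrow> real" and G :: "'a \<Rightarrow> 'a"
  assumes V: "integrable lborel V" and G: "integrable lborel G" and "convex \<Omega>"
    and weak: "\<And>n a b i. cbox a b \<subseteq> \<Omega> \<Longrightarrow> i \<in> Basis \<Longrightarrow>
      (\<integral>x. V x * frechet_derivative (box_bump n a b) (at x) i \<partial>lborel) =
      - (\<integral>x. (G x \<bullet> i) * box_bump n a b x \<partial>lborel)"
    and box: "\<And>x. x \<in> cbox a b \<Longrightarrow> x \<in> \<Omega> \<and> x + h \<in> \<Omega>"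
  shows "(\<integral>x. box_bump n a b x *
      (V (x + h) - V x - (\<integral>t. G (x + t *\<^sub>R h) \<bullet> h \<partial>unit_interval_measure)) \<partial>lborel) = 0"
proof -
  define \<phi> where "\<phi> = box_bump n a b"
  define P where "P x = (\<integral>t. G (x + t *\<^sub>R h) \<bullet> h \<partial>unit_interval_measure)" for x
  obtain D C where D: "\<And>x. (\<phi> has_derivative D x) (at x)"
    and cont: "\<And>h. continuous_on UNIV (\<lambda>x. D x h)" and C: "\<And>x h. \<bar>D x h\<bar> \<le> C h"
    using box_bump_C1 unfolding \<phi>_def by metis
  have \<phi>01: "\<bar>\<phi> x\<bar> \<le> 1" for x
    using box_bump_bounds[of n a b x] by (simp add: \<phi>_def)
  have [measurable]: "V \<in> borel_measurable borel" "G \<in> borel_measurable borel"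
    using V G by auto
  have [measurable]: "(\<lambda>x. D x b) \<in> borel_measurable borel" for b
    using cont by (rule borel_measurable_continuous_onI)
  have cont_\<phi>: "continuous_on UNIV \<phi>"
    using D by (auto simp: continuous_on_eq_continuous_at intro: has_derivative_continuous)
  then have [measurable]: "\<phi> \<in> borel_measurable borel"
    by (rule borel_measurable_continuous_onI)
  have D_translate: "((\<lambda>x. \<phi> (x - d)) has_derivative D (x - d)) (at x)" for x d
    by (rule has_derivative_compose[OF _ D, of "\<lambda>x. x - d" "\<lambda>h. h", simplified])
       (auto intro!: derivative_eq_intros)
  \<comment> \<open>Convexity enters here: a point of the translated box divides the segment from
    \<open>z - t *\<^sub>R h\<close> to its translate by \<open>h\<close> in the ratio given by
    \<open>t\<close>, and both ends lie in \<open>\<Omega>\<close>. Hence all intermediate bumps are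
    admissible.\<close>
  have in_\<Omega>: "cbox (a + t *\<^sub>R h) (b + t *\<^sub>R h) \<subseteq> \<Omega>" if "0 \<le> t" "t \<le> 1" for t
  proof
    fix z assume "z \<in> cbox (a + t *\<^sub>R h) (b + t *\<^sub>R h)"
    then have "z - t *\<^sub>R h \<in> cbox a b"
      by (simp add: mem_box inner_diff_left inner_add_left le_diff_eq diff_le_eq)
    then have "z - t *\<^sub>R h \<in> \<Omega>" "z - t *\<^sub>R h + h \<in> \<Omega>" using box by auto
    then have "(1 - t) *\<^sub>R (z - t *\<^sub>R h) + t *\<^sub>R (z - t *\<^sub>R h + h) \<in> \<Omega>"
      using \<open>convex \<Omega>\<close> that by (intro convexD) auto
    also have "(1 - t) *\<^sub>R (z - t *\<^sub>R h) + t *\<^sub>R (z - t *\<^sub>R h + h) = z"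
      by (simp add: algebra_simps)
    finally show "z \<in> \<Omega>" .
  qed
  have slice: "(\<integral>z. V z * D (z - t *\<^sub>R h) h \<partial>lborel) = - (\<integral>x. (G (x + t *\<^sub>R h) \<bullet> h) * \<phi> x \<partial>lborel)"
    if t: "0 \<le> t" "t \<le> 1" for t
  proof -
    let ?\<phi>t = "box_bump n (a + t *\<^sub>R h) (b + t *\<^sub>R h)"
    have eq: "?\<phi>t = (\<lambda>x. \<phi> (x - t *\<^sub>R h))"
      by (simp add: \<phi>_def box_bump_translate)
    have deriv: "(?\<phi>t has_derivative D (x - t *\<^sub>R h)) (at x)" for x
      unfolding eq by (rule D_translate)
    have "(\<integral>z. V z * D (z - t *\<^sub>R h) h \<partial>lborel) = - (\<integral>z. (G z \<bullet> h) * ?\<phi>t z \<partial>lborel)"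
    proof (rule integral_direction_derivative[where C="\<Sum>b\<in>Basis. C b", OF V G deriv])
      show "continuous_on UNIV (\<lambda>x. D (x - t *\<^sub>R h) b)" for b
        by (rule continuous_on_compose2[OF cont]) (auto intro!: continuous_intros)
      show "\<bar>D (x - t *\<^sub>R h) b\<bar> \<le> (\<Sum>b\<in>Basis. C b)" if "b \<in> Basis" for x b
      proof -
        have "0 \<le> C b" for b using C[of 0 b] by linarith
        then show ?thesis using C[of "x - t *\<^sub>R h" b] that by (meson finite_Basis member_le_sum order_trans)
      qed
      show "\<bar>?\<phi>t x\<bar> \<le> 1" for x unfolding eq by (rule \<phi>01)
      show "(\<integral>x. V x * D (x - t *\<^sub>R h) i \<partial>lborel) = - (\<integral>x. (G x \<bullet> i) * ?\<phi>t x \<partial>lborel)"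
        if "i \<in> Basis" for i
        using weak[OF in_\<Omega>[OF t] that] frechet_derivative_at[OF deriv] by simp
    qed
    also have "(\<integral>z. (G z \<bullet> h) * ?\<phi>t z \<partial>lborel) = (\<integral>x. (G (x + t *\<^sub>R h) \<bullet> h) * \<phi> x \<partial>lborel)"
      using integral_lborel_translate[of "\<lambda>z. (G z \<bullet> h) * ?\<phi>t z" "t *\<^sub>R h"] by (simp add: eq)
    finally show ?thesis .
  qed
  have FTC: "(\<integral>t. D (z - t *\<^sub>R h) h \<partial>unit_interval_measure) = \<phi> z - \<phi> (z - h)" for z
  proof -
    have lin: "D x (r *\<^sub>R h) = r * D x h" for x r
      using linear_cmul[OF has_derivative_linear[OF D], of x r h] by simp
    have "((\<lambda>t. \<phi> (z - t *\<^sub>R h)) has_derivative (\<lambda>r. D (z - t *\<^sub>R h) (- (r *\<^sub>R h)))) (at t)" for t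
      by (rule has_derivative_compose[OF _ D]) (auto intro!: derivative_eq_intros)
    \<comment> \<open>The argument moves in direction \<open>- h\<close>; negating the primitive
      cancels that sign.\<close>
    then have "((\<lambda>t. - \<phi> (z - t *\<^sub>R h)) has_real_derivative D (z - t *\<^sub>R h) h) (at t)" for t
      unfolding has_field_derivative_def
      using lin[of _ "- _"]
      by (auto intro!: derivative_eq_intros simp: mult.commute)
    then have "(\<integral>t. D (z - t *\<^sub>R h) h \<partial>unit_interval_measure) =
        (- \<phi> (z - 1 *\<^sub>R h)) - (- \<phi> (z - 0 *\<^sub>R h))"
      by (rule integral_unit_interval_measure_derivative)
         (rule continuous_on_compose2[OF cont], auto intro!: continuous_intros)
    then show ?thesis by simp
  qed
  have mult_\<phi>: "integrable lborel (\<lambda>x. \<phi> x * f x)" if f: "integrable lborel f" for f :: "'a \<Rightarrow> real"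
  proof (rule Bochner_Integration.integrable_bound[OF f])
    have "\<bar>\<phi> x\<bar> * \<bar>f x\<bar> \<le> 1 * \<bar>f x\<bar>" for x
      using \<phi>01 by (intro mult_right_mono) auto
    then show "AE x in lborel. norm (\<phi> x * f x) \<le> norm (f x)" by (simp add: abs_mult)
    show "(\<lambda>x. \<phi> x * f x) \<in> borel_measurable lborel" using f by simp
  qed
  have P: "integrable lborel P"
    using lborel_unit_interval.integrable_fst'[OF integrable_along_segments[OF G, of h]]
    by (simp add: P_def[abs_def])
  have Vh: "integrable lborel (\<lambda>x. V (x + h))" using V by (rule integrable_lborel_translate)

  have "(\<integral>x. \<phi> x * V (x + h) \<partial>lborel) = (\<integral>z. \<phi> (z - h) * V z \<partial>lborel)"
    using integral_lborel_translate[of "\<lambda>z. \<phi> (z - h) * V z" h] by simp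
  moreover have "integrable lborel (\<lambda>z. \<phi> (z - h) * V z)"
    using integrable_lborel_translate[OF mult_\<phi>[OF Vh], of "- h"] by simp
  ultimately have "(\<integral>x. \<phi> x * V (x + h) \<partial>lborel) - (\<integral>x. \<phi> x * V x \<partial>lborel) =
      (\<integral>z. \<phi> (z - h) * V z - \<phi> z * V z \<partial>lborel)"
    using mult_\<phi>[OF V] by simp
  also have "\<dots> = (\<integral>z. - (\<integral>t. V z * D (z - t *\<^sub>R h) h \<partial>unit_interval_measure) \<partial>lborel)"
    by (intro Bochner_Integration.integral_cong refl) (simp add: FTC algebra_simps)
  also have "\<dots> = - (\<integral>t. \<integral>z. V z * D (z - t *\<^sub>R h) h \<partial>lborel \<partial>unit_interval_measure)"
  proof -
    have "integrable (lborel \<Otimes>\<^sub>M unit_interval_measure) (\<lambda>(z, t). V z * D (z - t *\<^sub>R h) h)"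
    proof (rule lborel_unit_interval.integrable_pair_bounded_fst)
      show "integrable lborel (\<lambda>z. \<bar>V z\<bar> * C h)" using V by simp
      show "norm (case (z, t) of (z, t) \<Rightarrow> V z * D (z - t *\<^sub>R h) h) \<le> \<bar>V z\<bar> * C h" for z t
        using C by (auto simp: abs_mult intro!: mult_left_mono)
      show "(\<lambda>(z, t). V z * D (z - t *\<^sub>R h) h) \<in> borel_measurable (lborel \<Otimes>\<^sub>M unit_interval_measure)"
        by measurable
    qed (rule unit_interval.finite_measure_axioms)
    then show ?thesis
      using lborel_unit_interval.Fubini_integral[of "\<lambda>z t. V z * D (z - t *\<^sub>R h) h"] by simp
  qed
  also have "\<dots> = (\<integral>t. \<integral>x. (G (x + t *\<^sub>R h) \<bullet> h) * \<phi> x \<partial>lborel \<partial>unit_interval_measure)"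
  proof -
    have "(\<integral>t. \<integral>z. V z * D (z - t *\<^sub>R h) h \<partial>lborel \<partial>unit_interval_measure) =
        (\<integral>t. - (\<integral>x. (G (x + t *\<^sub>R h) \<bullet> h) * \<phi> x \<partial>lborel) \<partial>unit_interval_measure)"
    proof (intro integral_cong_AE)
      show "AE t in unit_interval_measure. (\<integral>z. V z * D (z - t *\<^sub>R h) h \<partial>lborel) =
          - (\<integral>x. (G (x + t *\<^sub>R h) \<bullet> h) * \<phi> x \<partial>lborel)"
        using AE_unit_interval_measure by eventually_elim (simp add: slice)
    qed auto
    then show ?thesis by simp
  qed
  also have "\<dots> = (\<integral>x. \<integral>t. (G (x + t *\<^sub>R h) \<bullet> h) * \<phi> x \<partial>unit_interval_measure \<partial>lborel)"
  proof (rule lborel_unit_interval.Fubini_integral,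
      rule Bochner_Integration.integrable_bound[OF integrable_along_segments[OF G, of h]])
    have "\<bar>G (x + t *\<^sub>R h) \<bullet> h\<bar> * \<bar>\<phi> x\<bar> \<le> \<bar>G (x + t *\<^sub>R h) \<bullet> h\<bar> * 1" for x t
      using \<phi>01 by (intro mult_left_mono) auto
    then show "AE z in lborel \<Otimes>\<^sub>M unit_interval_measure.
        norm (case z of (x, t) \<Rightarrow> (G (x + t *\<^sub>R h) \<bullet> h) * \<phi> x)
        \<le> norm (case z of (x, t) \<Rightarrow> G (x + t *\<^sub>R h) \<bullet> h)"
      by (auto simp: abs_mult)
  qed measurable
  also have "\<dots> = (\<integral>x. \<phi> x * P x \<partial>lborel)"
    by (simp add: P_def mult.commute)
  finally have "(\<integral>x. \<phi> x * V (x + h) \<partial>lborel) - (\<integral>x. \<phi> x * V x \<partial>lborel) - (\<integral>x. \<phi> x * P x \<partial>lborel) = 0"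
    by simp
  then have "(\<integral>x. \<phi> x * (V (x + h) - V x - P x) \<partial>lborel) = 0"
    using mult_\<phi>[OF V] mult_\<phi>[OF Vh] mult_\<phi>[OF P] by (simp add: right_diff_distrib)
  then show ?thesis by (simp add: \<phi>_def P_def)
qed

text \<open>On the open set \<open>U\<close> where both \<open>x\<close> and \<open>x + h\<close>
  lie in \<open>\<Omega>\<close>, the defect \<open>F\<close> integrates to 0 against every bump.
  Dominated convergence in \<open>n\<close> replaces bumps by indicators of boxes, so
  \<open>F\<close> vanishes almost everywhere on \<open>U\<close>. The exceptional null set may
  depend on \<open>h\<close>.\<close>

lemma weak_gradient_difference:
  fixes V :: "'a::euclidean_space \<Rightarrow> real" and G :: "'a \<Rightarrow> 'a"
  assumes V: "integrable lborel V" and G: "integrable lborel G" and "open \<Omega>" "convex \<Omega>"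
    and weak: "\<And>n a b i. cbox a b \<subseteq> \<Omega> \<Longrightarrow> i \<in> Basis \<Longrightarrow>
      (\<integral>x. V x * frechet_derivative (box_bump n a b) (at x) i \<partial>lborel) =
      - (\<integral>x. (G x \<bullet> i) * box_bump n a b x \<partial>lborel)"
  shows "AE x in lborel. x \<in> \<Omega> \<and> x + h \<in> \<Omega> \<longrightarrow>
      V (x + h) - V x = (\<integral>t. G (x + t *\<^sub>R h) \<bullet> h \<partial>unit_interval_measure)"
proof -
  define F where "F x = V (x + h) - V x - (\<integral>t. G (x + t *\<^sub>R h) \<bullet> h \<partial>unit_interval_measure)" for x
  define U where "U = \<Omega> \<inter> (\<lambda>x. x + h) -` \<Omega>"
  have F: "integrable lborel F"
    unfolding F_def
    using lborel_unit_interval.integrable_fst'[OF integrable_along_segments[OF G, of h]]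
      integrable_lborel_translate[OF V, of h] V by simp
  have "open U"
    unfolding U_def using \<open>open \<Omega>\<close>
    by (intro open_Int open_vimage continuous_intros) auto
  have "AE x in lborel. x \<in> U \<longrightarrow> F x = 0"
  proof (rule AE_zero_if_integral_boxes_zero[OF F \<open>open U\<close>])
    fix a b assume ab: "cbox a b \<subseteq> U"
    have "(\<lambda>n. \<integral>x. box_bump n a b x * F x \<partial>lborel) \<longlonglongrightarrow> (\<integral>x. indicator (box a b) x * F x \<partial>lborel)"
    proof (rule integral_dominated_convergence[where w="\<lambda>x. \<bar>F x\<bar>"])
      have "continuous_on UNIV (box_bump n a b)" for n
        using C_k_smooth_elementary[OF smooth_elementary_box_bump, of 0] by simp
      then have [measurable]: "box_bump n a b \<in> borel_measurable borel" for n
        by (rule borel_measurable_continuous_onI)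
      show "(\<lambda>x. box_bump n a b x * F x) \<in> borel_measurable lborel" for n
        using F by simp
      show "(\<lambda>x. indicator (box a b) x * F x) \<in> borel_measurable lborel"
        using F by simp
      show "AE x in lborel. (\<lambda>n. box_bump n a b x * F x) \<longlonglongrightarrow> indicator (box a b) x * F x"
        by (intro AE_I2 tendsto_mult_right box_bump_tendsto_indicator)
      show "AE x in lborel. norm (box_bump n a b x * F x) \<le> \<bar>F x\<bar>" for n
        using box_bump_bounds[of n a b]
        by (intro AE_I2) (auto simp: abs_mult intro!: mult_left_le_one_le)
    qed (use F in simp)
    moreover have "(\<integral>x. box_bump n a b x * F x \<partial>lborel) = 0" for n
      unfolding F_def
      by (rule weak_gradient_difference_integral_bump[OF V G \<open>convex \<Omega>\<close> weak])
         (use ab in \<open>auto simp: U_def\<close>)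
    ultimately show "(\<integral>x. indicator (box a b) x * F x \<partial>lborel) = 0"
      by (simp add: LIMSEQ_const_iff)
  qed
  then show ?thesis
    by eventually_elim (auto simp: U_def F_def)
qed

section \<open>The double integral of differences\<close>

text \<open>Jensen's inequality in a form that requires no integrability: if the power is not
  integrable, the right-hand side is infinite.\<close>

lemma (in finite_measure) powr_integral_le_nn_integral:
  fixes f :: "'a \<Rightarrow> real"
  assumes [measurable]: "f \<in> borel_measurable M" and "1 < r" and prob: "measure M (space M) = 1"
  shows "ennreal (\<bar>\<integral>x. f x \<partial>M\<bar> powr r) \<le> (\<integral>\<^sup>+x. ennreal (\<bar>f x\<bar> powr r) \<partial>M)"
proof (cases "integrable M (\<lambda>x. \<bar>f x\<bar> powr r)")
  case True
  have "integrable M f"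
    using integrable_powr_mono[OF _ True, of 1] \<open>1 < r\<close> by (simp add: integrable_abs_iff)
  then have "\<bar>\<integral>x. f x \<partial>M\<bar> powr r \<le> (\<integral>x. \<bar>f x\<bar> powr r \<partial>M)"
    using powr_integral_le[OF _ True \<open>1 < r\<close>] prob by simp
  then show ?thesis
    using nn_integral_eq_integral[OF True] by (simp add: ennreal_leI)
next
  case False
  then have "(\<integral>\<^sup>+x. ennreal (\<bar>f x\<bar> powr r) \<partial>M) = \<infinity>"
    by (simp add: integrable_iff_bounded not_less top_unique)
  then show ?thesis by simp
qed

text \<open>Integrating over \<open>h\<close> first removes the dependence on \<open>x\<close> at
  the cost of the Jacobian factor; the remaining integral over \<open>x\<close> is the measure of
  \<open>A\<close>.\<close>

lemma nn_integral_convolution_le: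
  fixes g :: "'a::euclidean_space \<Rightarrow> ennreal"
  assumes [measurable]: "g \<in> borel_measurable borel" "A \<in> sets borel" and s: "1 / 2 \<le> \<bar>s\<bar>"
  shows "(\<integral>\<^sup>+h. \<integral>\<^sup>+x. indicator A x * g (x + s *\<^sub>R h) \<partial>lborel \<partial>lborel)
    \<le> ennreal (2 ^ DIM('a)) * emeasure lborel A * (\<integral>\<^sup>+x. g x \<partial>lborel)"
proof -
  have "(\<integral>\<^sup>+h. \<integral>\<^sup>+x. indicator A x * g (x + s *\<^sub>R h) \<partial>lborel \<partial>lborel) =
      (\<integral>\<^sup>+x. \<integral>\<^sup>+h. indicator A x * g (x + s *\<^sub>R h) \<partial>lborel \<partial>lborel)"
    by (rule lborel_pair.Fubini') measurable
  also have "\<dots> = (\<integral>\<^sup>+x. indicator A x * (\<integral>\<^sup>+h. g (x + s *\<^sub>R h) \<partial>lborel) \<partial>lborel)"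
    by (simp add: nn_integral_cmult)
  also have "\<dots> \<le> (\<integral>\<^sup>+x. indicator A x * (ennreal (2 ^ DIM('a)) * (\<integral>\<^sup>+x. g x \<partial>lborel)) \<partial>lborel)"
    by (intro nn_integral_mono mult_left_mono nn_integral_lborel_affine_le s) auto
  also have "\<dots> = ennreal (2 ^ DIM('a)) * emeasure lborel A * (\<integral>\<^sup>+x. g x \<partial>lborel)"
    by (subst nn_integral_multc) (auto simp: mult_ac)
  finally show ?thesis .
qed

text \<open>Either \<open>t\<close> or \<open>1 - t\<close> is at least \<open>1 / 2\<close>, so on each segment one may integrate first over
  the end point that is farther from \<open>x + t h\<close>.\<close>

lemma nn_integral_segment_le:
  fixes g :: "'a::euclidean_space \<Rightarrow> ennreal"
  assumes [measurable]: "g \<in> borel_measurable borel" "A \<in> sets borel"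
  shows "(\<integral>\<^sup>+h. \<integral>\<^sup>+x. indicator A x * indicator A (x + h) * g (x + t *\<^sub>R h) \<partial>lborel \<partial>lborel)
    \<le> ennreal (2 ^ DIM('a)) * emeasure lborel A * (\<integral>\<^sup>+x. g x \<partial>lborel)" (is "?L \<le> ?R")
proof (cases "1 / 2 \<le> t")
  case True
  have "?L \<le> (\<integral>\<^sup>+h. \<integral>\<^sup>+x. indicator A x * g (x + t *\<^sub>R h) \<partial>lborel \<partial>lborel)"
    by (intro nn_integral_mono) (auto simp: indicator_def)
  also have "\<dots> \<le> ?R"
    using True by (intro nn_integral_convolution_le) auto
  finally show ?thesis .
next
  case False
  have "?L \<le> (\<integral>\<^sup>+h. \<integral>\<^sup>+x. indicator A (h + x) * g (h + x + (t - 1) *\<^sub>R h) \<partial>lborel \<partial>lborel)"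
    by (intro nn_integral_mono) (auto simp: indicator_def algebra_simps)
  also have "\<dots> = (\<integral>\<^sup>+h. \<integral>\<^sup>+x. indicator A x * g (x + (t - 1) *\<^sub>R h) \<partial>lborel \<partial>lborel)"
    by (intro nn_integral_cong nn_integral_lborel_translate) measurable
  also have "\<dots> \<le> ?R"
    using False by (intro nn_integral_convolution_le) auto
  finally show ?thesis .
qed

text \<open>After the substitution \<open>y = x + h\<close>, the segment formula, Jensen's
  inequality in \<open>t\<close> and Cauchy-Schwarz with \<open>norm h \<le> d\<close> bound the
  integrand by an average of powers of \<open>d * norm (G (x + t *\<^sub>R h))\<close>. Each fixed
  \<open>t\<close> is then handled by \<open>nn_integral_segment_le\<close>.\<close>

lemma double_integral_difference_le:
  fixes V :: "'a::euclidean_space \<Rightarrow> real" and G :: "'a \<Rightarrow> 'a"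
  assumes V: "integrable lborel V" and G: "integrable lborel G"
    and "open \<Omega>" "convex \<Omega>" "1 < q"
    and dist_le: "\<And>x y. x \<in> \<Omega> \<Longrightarrow> y \<in> \<Omega> \<Longrightarrow> dist x y \<le> d"
    and weak: "\<And>n a b i. cbox a b \<subseteq> \<Omega> \<Longrightarrow> i \<in> Basis \<Longrightarrow>
      (\<integral>x. V x * frechet_derivative (box_bump n a b) (at x) i \<partial>lborel) =
      - (\<integral>x. (G x \<bullet> i) * box_bump n a b x \<partial>lborel)"
  shows "(\<integral>\<^sup>+x. \<integral>\<^sup>+y. indicator \<Omega> x * indicator \<Omega> y * ennreal (\<bar>V y - V x\<bar> powr q) \<partial>lborel \<partial>lborel)
    \<le> ennreal (2 ^ DIM('a)) * emeasure lborel \<Omega> * (\<integral>\<^sup>+x. ennreal ((d * norm (G x)) powr q) \<partial>lborel)"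
proof -
  let ?g = "\<lambda>x. ennreal ((d * norm (G x)) powr q)"
  have [measurable]: "V \<in> borel_measurable borel" "G \<in> borel_measurable borel" "\<Omega> \<in> sets borel"
    using V G \<open>open \<Omega>\<close> by auto
  have difference: "AE x in lborel. x \<in> \<Omega> \<and> x + h \<in> \<Omega> \<longrightarrow>
      V (x + h) - V x = (\<integral>t. G (x + t *\<^sub>R h) \<bullet> h \<partial>unit_interval_measure)" for h
    by (rule weak_gradient_difference[OF V G \<open>open \<Omega>\<close> \<open>convex \<Omega>\<close>]) (rule weak)
  have "(\<integral>\<^sup>+x. \<integral>\<^sup>+y. indicator \<Omega> x * indicator \<Omega> y * ennreal (\<bar>V y - V x\<bar> powr q) \<partial>lborel \<partial>lborel) =
      (\<integral>\<^sup>+x. \<integral>\<^sup>+h. indicator \<Omega> x * indicator \<Omega> (x + h) * ennreal (\<bar>V (x + h) - V x\<bar> powr q) \<partial>lborel \<partial>lborel)"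
    by (intro nn_integral_cong nn_integral_lborel_translate[symmetric]) measurable
  \<comment> \<open>The variable \<open>h\<close> goes outermost because the difference formula
    holds for fixed \<open>h\<close> and almost every \<open>x\<close>.\<close>
  also have "\<dots> = (\<integral>\<^sup>+h. \<integral>\<^sup>+x. indicator \<Omega> x * indicator \<Omega> (x + h) * ennreal (\<bar>V (x + h) - V x\<bar> powr q) \<partial>lborel \<partial>lborel)"
    by (rule lborel_pair.Fubini'[symmetric]) measurable
  also have "\<dots> \<le> (\<integral>\<^sup>+h. \<integral>\<^sup>+x. \<integral>\<^sup>+t. indicator \<Omega> x * indicator \<Omega> (x + h) * ?g (x + t *\<^sub>R h)
      \<partial>unit_interval_measure \<partial>lborel \<partial>lborel)"
  proof (rule nn_integral_mono, rule nn_integral_mono_AE)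
    fix h :: 'a
    show "AE x in lborel. indicator \<Omega> x * indicator \<Omega> (x + h) * ennreal (\<bar>V (x + h) - V x\<bar> powr q)
        \<le> (\<integral>\<^sup>+t. indicator \<Omega> x * indicator \<Omega> (x + h) * ?g (x + t *\<^sub>R h) \<partial>unit_interval_measure)"
      using difference[of h]
    proof eventually_elim
      case (elim x)
      show ?case
      proof (cases "x \<in> \<Omega> \<and> x + h \<in> \<Omega>")
        case True
        then have "norm h \<le> d" using dist_le[of x "x + h"] by (simp add: dist_norm)
        have "ennreal (\<bar>V (x + h) - V x\<bar> powr q) =
            ennreal (\<bar>\<integral>t. G (x + t *\<^sub>R h) \<bullet> h \<partial>unit_interval_measure\<bar> powr q)"
          using elim True by simp
        also have "\<dots> \<le> (\<integral>\<^sup>+t. ennreal (\<bar>G (x + t *\<^sub>R h) \<bullet> h\<bar> powr q) \<partial>unit_interval_measure)"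
          by (rule unit_interval.powr_integral_le_nn_integral) (use \<open>1 < q\<close> in auto)
        also have "\<dots> \<le> (\<integral>\<^sup>+t. ?g (x + t *\<^sub>R h) \<partial>unit_interval_measure)"
        proof (intro nn_integral_mono ennreal_leI powr_mono2)
          fix t
          have "\<bar>G (x + t *\<^sub>R h) \<bullet> h\<bar> \<le> norm (G (x + t *\<^sub>R h)) * norm h"
            by (rule Cauchy_Schwarz_ineq2)
          also have "\<dots> \<le> norm (G (x + t *\<^sub>R h)) * d"
            using \<open>norm h \<le> d\<close> by (intro mult_left_mono) auto
          finally show "\<bar>G (x + t *\<^sub>R h) \<bullet> h\<bar> \<le> d * norm (G (x + t *\<^sub>R h))"
            by (simp add: mult.commute)
        qed (use \<open>1 < q\<close> in auto)
        finally show ?thesis using True by simp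
      qed (auto simp: indicator_def)
    qed
  qed
  also have "\<dots> = (\<integral>\<^sup>+h. \<integral>\<^sup>+t. \<integral>\<^sup>+x. indicator \<Omega> x * indicator \<Omega> (x + h) * ?g (x + t *\<^sub>R h)
      \<partial>lborel \<partial>unit_interval_measure \<partial>lborel)"
    by (intro nn_integral_cong lborel_unit_interval.Fubini'[symmetric]) measurable
  also have "\<dots> = (\<integral>\<^sup>+t. \<integral>\<^sup>+h. \<integral>\<^sup>+x. indicator \<Omega> x * indicator \<Omega> (x + h) * ?g (x + t *\<^sub>R h)
      \<partial>lborel \<partial>lborel \<partial>unit_interval_measure)"
    by (rule lborel_unit_interval.Fubini'[symmetric]) measurable
  also have "\<dots> \<le> (\<integral>\<^sup>+t. ennreal (2 ^ DIM('a)) * emeasure lborel \<Omega> * (\<integral>\<^sup>+x. ?g x \<partial>lborel) \<partial>unit_interval_measure)"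
    by (intro nn_integral_mono nn_integral_segment_le) measurable
  also have "\<dots> = ennreal (2 ^ DIM('a)) * emeasure lborel \<Omega> * (\<integral>\<^sup>+x. ?g x \<partial>lborel)"
    by (simp add: emeasure_unit_interval_measure_UNIV)
  finally show ?thesis .
qed

section \<open>Minimality of the unshifted power integral\<close>

text \<open>The tangent inequality at \<open>f x\<close>, evaluated at \<open>f x - c\<close>, has a
  linear term proportional to \<open>\<bar>f x\<bar> powr (q - 2) * f x\<close>, which integrates to
  0 by \<open>mean\<close>. That term is integrable because its absolute value is the power
  \<open>q - 1\<close> of \<open>\<bar>f x\<bar>\<close>.\<close>

lemma (in finite_measure) nn_integral_powr_le_shift:
  fixes f :: "'a \<Rightarrow> real"
  assumes [measurable]: "f \<in> borel_measurable M" and "1 < q"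
    and f_q: "integrable M (\<lambda>x. \<bar>f x\<bar> powr q)"
    and mean: "(\<integral>x. \<bar>f x\<bar> powr (q - 2) * f x \<partial>M) = 0"
  shows "ennreal (\<integral>x. \<bar>f x\<bar> powr q \<partial>M) \<le> (\<integral>\<^sup>+x. ennreal (\<bar>f x - c\<bar> powr q) \<partial>M)"
proof (cases "integrable M (\<lambda>x. \<bar>f x - c\<bar> powr q)")
  case True
  have "integrable M (\<lambda>x. \<bar>f x\<bar> powr (q - 1))"
    using \<open>1 < q\<close> by (intro integrable_powr_mono[OF _ f_q]) auto
  moreover have abs_eq: "\<bar>\<bar>s\<bar> powr (q - 2) * s\<bar> = \<bar>s\<bar> powr (q - 1)" for s :: real
  proof -
    have "\<bar>s\<bar> powr ((q - 2) + 1) = \<bar>s\<bar> powr (q - 2) * \<bar>s\<bar> powr 1" by (rule powr_add)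
    then show ?thesis by (simp add: abs_mult)
  qed
  ultimately have "integrable M (\<lambda>x. \<bar>\<bar>f x\<bar> powr (q - 2) * f x\<bar>)"
    unfolding abs_eq by simp
  then have int: "integrable M (\<lambda>x. \<bar>f x\<bar> powr (q - 2) * f x)"
    by (subst (asm) integrable_abs_iff) measurable
  have "(\<integral>x. \<bar>f x\<bar> powr q + q * (\<bar>f x\<bar> powr (q - 2) * f x) * ((f x - c) - f x) \<partial>M)
      \<le> (\<integral>x. \<bar>f x - c\<bar> powr q \<partial>M)"
    using True f_q int \<open>1 < q\<close> by (intro integral_mono powr_tangent_inequality) auto
  also have "(\<integral>x. \<bar>f x\<bar> powr q + q * (\<bar>f x\<bar> powr (q - 2) * f x) * ((f x - c) - f x) \<partial>M) =
      (\<integral>x. \<bar>f x\<bar> powr q \<partial>M)"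
    using f_q int mean by simp
  finally show ?thesis
    using nn_integral_eq_integral[OF True] by (simp add: ennreal_leI)
next
  case False
  then have "(\<integral>\<^sup>+x. ennreal (\<bar>f x - c\<bar> powr q) \<partial>M) = \<infinity>"
    by (simp add: integrable_iff_bounded not_less top_unique)
  then show ?thesis by simp
qed

section \<open>From Lebesgue measurable functions on a domain to Borel functions on the
  space\<close>

text \<open>The product and substitution arguments above work with Borel functions on the whole
  space, whereas members of \<open>Lp\<close> are only Lebesgue measurable on
  \<open>\<Omega>\<close>. The components are replaced one by one, and their finitely many null sets
  combine. Extension by 0 lets whole-space integrals stand for integrals over
  \<open>\<Omega>\<close>.\<close>

lemma borel_representative:
  fixes f :: "'a::euclidean_space \<Rightarrow> 'b::euclidean_space"
  assumes [measurable]: "\<Omega> \<in> sets borel" and f: "f \<in> borel_measurable (lebesgue_on \<Omega>)"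
  obtains F where "F \<in> borel_measurable borel" "AE x in lborel. x \<in> \<Omega> \<longrightarrow> f x = F x"
    "\<And>x. x \<notin> \<Omega> \<Longrightarrow> F x = 0"
proof -
  have "(\<lambda>x. indicator \<Omega> x *\<^sub>R f x) \<in> borel_measurable lebesgue"
    using f by (subst (asm) borel_measurable_restrict_space_iff) auto
  then have "(\<lambda>x. (indicator \<Omega> x *\<^sub>R f x) \<bullet> b) \<in> borel_measurable lebesgue" for b
    by (intro borel_measurable_inner) auto
  then have "\<exists>F. F \<in> borel_measurable borel \<and> (AE x in lborel. (indicator \<Omega> x *\<^sub>R f x) \<bullet> b = F x)" for b
    using completion_ex_borel_measurable_real[of "\<lambda>x. (indicator \<Omega> x *\<^sub>R f x) \<bullet> b" lborel] by auto
  then obtain F where F: "\<And>b. F b \<in> borel_measurable borel"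
    "\<And>b. AE x in lborel. (indicator \<Omega> x *\<^sub>R f x) \<bullet> b = F b x"
    by metis
  note F(1) [measurable]
  let ?F = "\<lambda>x. indicator \<Omega> x *\<^sub>R (\<Sum>b\<in>Basis. F b x *\<^sub>R b)"
  have "AE x in lborel. \<forall>b\<in>Basis. (indicator \<Omega> x *\<^sub>R f x) \<bullet> b = F b x"
    using F(2) by (intro AE_finite_allI) auto
  then have "AE x in lborel. x \<in> \<Omega> \<longrightarrow> f x = ?F x"
    by eventually_elim (auto simp: euclidean_eq_iff[where 'a='b])
  moreover have "?F \<in> borel_measurable borel" by measurable
  ultimately show ?thesis by (intro that[of ?F]) auto
qed

lemma lebesgue_on_eq_lborel:
  fixes f F :: "'a::euclidean_space \<Rightarrow> 'b::{banach, second_countable_topology}"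
  assumes [measurable]: "\<Omega> \<in> sets borel" and f: "f \<in> borel_measurable (lebesgue_on \<Omega>)"
    and F[measurable]: "F \<in> borel_measurable borel"
    and AE: "AE x in lborel. x \<in> \<Omega> \<longrightarrow> f x = F x" and F0: "\<And>x. x \<notin> \<Omega> \<Longrightarrow> F x = 0"
  shows "integrable (lebesgue_on \<Omega>) f \<longleftrightarrow> integrable lborel F"
    and "(LINT x|lebesgue_on \<Omega>. f x) = (\<integral>x. F x \<partial>lborel)"
proof -
  have meas: "(\<lambda>x. indicator \<Omega> x *\<^sub>R f x) \<in> borel_measurable lebesgue"
    using f by (subst (asm) borel_measurable_restrict_space_iff) auto
  have F_meas: "F \<in> borel_measurable lebesgue"
    using F by (simp add: measurable_completion)
  have AE': "AE x in lebesgue. indicator \<Omega> x *\<^sub>R f x = F x"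
  proof (rule AE_completion)
    show "AE x in lborel. indicator \<Omega> x *\<^sub>R f x = F x"
      using AE by eventually_elim (use F0 in \<open>auto simp: indicator_def\<close>)
  qed
  have "integrable (lebesgue_on \<Omega>) f \<longleftrightarrow> integrable lebesgue (\<lambda>x. indicator \<Omega> x *\<^sub>R f x)"
    by (rule integrable_restrict_space) simp
  also have "\<dots> \<longleftrightarrow> integrable lebesgue F"
    using meas F_meas AE' by (rule integrable_cong_AE)
  also have "\<dots> \<longleftrightarrow> integrable lborel F" by (rule integrable_completion) simp
  finally show "integrable (lebesgue_on \<Omega>) f \<longleftrightarrow> integrable lborel F" .
  have "(LINT x|lebesgue_on \<Omega>. f x) = (LINT x|lebesgue. indicator \<Omega> x *\<^sub>R f x)"
    by (rule integral_restrict_space) simp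
  also have "\<dots> = (LINT x|lebesgue. F x)"
    using meas F_meas AE' by (rule integral_cong_AE)
  also have "\<dots> = (\<integral>x. F x \<partial>lborel)" by (rule integral_completion) simp
  finally show "(LINT x|lebesgue_on \<Omega>. f x) = (\<integral>x. F x \<partial>lborel)" .
qed

lemma finite_measure_lebesgue_on_bounded:
  assumes "bounded \<Omega>" "open \<Omega>"
  shows "finite_measure (lebesgue_on \<Omega>)"
proof
  have "emeasure lebesgue \<Omega> < \<infinity>"
    using emeasure_bounded_finite[OF \<open>bounded \<Omega>\<close>] \<open>open \<Omega>\<close> by simp
  then show "emeasure (lebesgue_on \<Omega>) (space (lebesgue_on \<Omega>)) \<noteq> \<infinity>"
    using \<open>open \<Omega>\<close> by (simp add: emeasure_restrict_space)
qed

section \<open>The Poincare inequality on convex sets\<close>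

text \<open>Averaging the shift inequality over \<open>c = V x\<close> puts the measure of
  \<open>\<Omega>\<close> on the left, and the double integral estimate puts it on the right. It
  cancels, so the constant depends on the dimension, \<open>d\<close> and \<open>q\<close>
  only.\<close>

lemma poincare_convex:
  fixes \<Omega> :: "'a::euclidean_space set" and v :: "'a \<Rightarrow> real" and g :: "'a \<Rightarrow> 'a"
  assumes \<Omega>: "open \<Omega>" "bounded \<Omega>" "convex \<Omega>" "\<Omega> \<noteq> {}" and "1 < q" "q \<le> p" "diameter \<Omega> \<le> d"
    and v: "v \<in> Lp p \<Omega>" and g: "g \<in> Lp p \<Omega>" and vg: "has_weak_gradient \<Omega> v g"
    and mean: "(LINT x|lebesgue_on \<Omega>. \<bar>v x\<bar> powr (q - 2) * v x) = 0"
  shows "(LINT x|lebesgue_on \<Omega>. \<bar>v x\<bar> powr q) \<le>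
    2 ^ DIM('a) * d powr q * (LINT x|lebesgue_on \<Omega>. norm (g x) powr q)"
proof -
  interpret \<Omega>: finite_measure "lebesgue_on \<Omega>"
    using \<Omega> by (intro finite_measure_lebesgue_on_bounded)
  have \<Omega>_borel [measurable]: "\<Omega> \<in> sets borel" using \<Omega> by simp
  have v_meas [measurable]: "v \<in> borel_measurable (lebesgue_on \<Omega>)"
    and g_meas [measurable]: "g \<in> borel_measurable (lebesgue_on \<Omega>)"
    using v g by (auto simp: Lp_def)
  have v_int: "integrable (lebesgue_on \<Omega>) (\<lambda>x. \<bar>v x\<bar> powr r)" if "0 \<le> r" "r \<le> p" for r
    using v that by (intro \<Omega>.integrable_powr_mono[of v p r]) (auto simp: Lp_def)
  have g_int: "integrable (lebesgue_on \<Omega>) (\<lambda>x. norm (g x) powr r)" if "0 \<le> r" "r \<le> p" for r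
    using g that \<Omega>.integrable_powr_mono[of "\<lambda>x. norm (g x)" p r] by (auto simp: Lp_def)
  obtain V where V[measurable]: "V \<in> borel_measurable borel"
    and vV: "AE x in lborel. x \<in> \<Omega> \<longrightarrow> v x = V x" and V0: "\<And>x. x \<notin> \<Omega> \<Longrightarrow> V x = 0"
    using borel_representative[OF \<Omega>_borel v_meas] by metis
  obtain G where G[measurable]: "G \<in> borel_measurable borel"
    and gG: "AE x in lborel. x \<in> \<Omega> \<longrightarrow> g x = G x" and G0: "\<And>x. x \<notin> \<Omega> \<Longrightarrow> G x = 0"
    using borel_representative[OF \<Omega>_borel g_meas] by metis
  have V_int: "integrable lborel V"
  proof -
    have "integrable (lebesgue_on \<Omega>) v"
      using v_int[of 1] \<open>1 < q\<close> \<open>q \<le> p\<close> by (simp add: integrable_abs_iff)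
    then show ?thesis
      by (subst lebesgue_on_eq_lborel(1)[OF \<Omega>_borel v_meas V vV V0, symmetric])
  qed
  have G_int: "integrable lborel G"
  proof -
    have "integrable (lebesgue_on \<Omega>) g"
      using g_int[of 1] \<open>1 < q\<close> \<open>q \<le> p\<close> by (simp add: integrable_norm_iff)
    then show ?thesis
      by (subst lebesgue_on_eq_lborel(1)[OF \<Omega>_borel g_meas G gG G0, symmetric])
  qed
  have Gq_meas: "(\<lambda>x. norm (g x) powr q) \<in> borel_measurable (lebesgue_on \<Omega>)" by measurable
  have gGq: "AE x in lborel. x \<in> \<Omega> \<longrightarrow> norm (g x) powr q = norm (G x) powr q"
    using gG by eventually_elim simp
  have Gq: "integrable lborel (\<lambda>x. norm (G x) powr q)"
    "(LINT x|lebesgue_on \<Omega>. norm (g x) powr q) = (\<integral>x. norm (G x) powr q \<partial>lborel)"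
    using lebesgue_on_eq_lborel[OF \<Omega>_borel Gq_meas _ gGq] g_int[of q] \<open>1 < q\<close> \<open>q \<le> p\<close> G0 by auto
  define I where "I = (LINT x|lebesgue_on \<Omega>. \<bar>v x\<bar> powr q)"
  have weak: "(\<integral>x. V x * frechet_derivative (box_bump n a b) (at x) i \<partial>lborel) =
      - (\<integral>x. (G x \<bullet> i) * box_bump n a b x \<partial>lborel)" if ab: "cbox a b \<subseteq> \<Omega>" and i: "i \<in> Basis" for n a b i
  proof -
    let ?\<phi> = "box_bump n a b" and ?\<phi>' = "\<lambda>x. frechet_derivative (box_bump n a b) (at x) i"
    have "C_k 1 ?\<phi>" "C_k 0 ?\<phi>"
      by (rule C_k_smooth_elementary[OF smooth_elementary_box_bump])+
    then have "continuous_on UNIV ?\<phi>'" "continuous_on UNIV ?\<phi>"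
      using i by auto
    then have [measurable]: "?\<phi>' \<in> borel_measurable borel" "?\<phi> \<in> borel_measurable borel"
      by (auto intro: borel_measurable_continuous_onI)
    have [measurable]: "?\<phi>' \<in> borel_measurable (lebesgue_on \<Omega>)" "?\<phi> \<in> borel_measurable (lebesgue_on \<Omega>)"
      by (auto intro!: measurable_restrict_space1 measurable_completion)
    have "(LINT x|lebesgue_on \<Omega>. v x * ?\<phi>' x) = (\<integral>x. V x * ?\<phi>' x \<partial>lborel)"
    proof (rule lebesgue_on_eq_lborel(2)[OF \<Omega>_borel])
      show "AE x in lborel. x \<in> \<Omega> \<longrightarrow> v x * ?\<phi>' x = V x * ?\<phi>' x"
        using vV by eventually_elim simp
    qed (use V0 in \<open>auto\<close>)
    moreover have "(LINT x|lebesgue_on \<Omega>. (g x \<bullet> i) * ?\<phi> x) = (\<integral>x. (G x \<bullet> i) * ?\<phi> x \<partial>lborel)"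
    proof (rule lebesgue_on_eq_lborel(2)[OF \<Omega>_borel])
      show "AE x in lborel. x \<in> \<Omega> \<longrightarrow> (g x \<bullet> i) * ?\<phi> x = (G x \<bullet> i) * ?\<phi> x"
        using gG by eventually_elim simp
    qed (use G0 in \<open>auto\<close>)
    ultimately show ?thesis
      using vg test_function_box_bump[OF ab] i by (simp add: has_weak_gradient_def)
  qed
  have dist_le: "dist x y \<le> d" if "x \<in> \<Omega>" "y \<in> \<Omega>" for x y
    using diameter_bounded_bound[OF \<open>bounded \<Omega>\<close> that] \<open>diameter \<Omega> \<le> d\<close> by simp
  have "d \<ge> 0" using dist_le \<open>\<Omega> \<noteq> {}\<close> by (metis all_not_in_conv dist_self)
  have shift: "ennreal I \<le> (\<integral>\<^sup>+x. indicator \<Omega> x * ennreal (\<bar>V x - c\<bar> powr q) \<partial>lborel)" for c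
  proof -
    have "ennreal I \<le> (\<integral>\<^sup>+x. ennreal (\<bar>v x - c\<bar> powr q) \<partial>lebesgue_on \<Omega>)"
      unfolding I_def using v_int[of q] mean \<open>1 < q\<close> \<open>q \<le> p\<close>
      by (intro \<Omega>.nn_integral_powr_le_shift) auto
    also have "\<dots> = (\<integral>\<^sup>+x. ennreal (\<bar>v x - c\<bar> powr q) * indicator \<Omega> x \<partial>lebesgue)"
      by (intro nn_integral_restrict_space) simp
    also have "\<dots> = (\<integral>\<^sup>+x. ennreal (\<bar>v x - c\<bar> powr q) * indicator \<Omega> x \<partial>lborel)"
      by (rule nn_integral_completion)
    also have "\<dots> = (\<integral>\<^sup>+x. indicator \<Omega> x * ennreal (\<bar>V x - c\<bar> powr q) \<partial>lborel)"
    proof (rule nn_integral_cong_AE)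
      show "AE x in lborel. ennreal (\<bar>v x - c\<bar> powr q) * indicator \<Omega> x =
          indicator \<Omega> x * ennreal (\<bar>V x - c\<bar> powr q)"
        using vV by eventually_elim (auto simp: indicator_def)
    qed
    finally show ?thesis .
  qed
  have "emeasure lborel \<Omega> * ennreal I = (\<integral>\<^sup>+x. indicator \<Omega> x * ennreal I \<partial>lborel)"
    by (simp add: nn_integral_multc)
  also have "\<dots> \<le> (\<integral>\<^sup>+x. indicator \<Omega> x * (\<integral>\<^sup>+y. indicator \<Omega> y * ennreal (\<bar>V y - V x\<bar> powr q) \<partial>lborel) \<partial>lborel)"
    by (intro nn_integral_mono mult_left_mono shift) auto
  also have "\<dots> = (\<integral>\<^sup>+x. \<integral>\<^sup>+y. indicator \<Omega> x * indicator \<Omega> y * ennreal (\<bar>V y - V x\<bar> powr q) \<partial>lborel \<partial>lborel)"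
    by (simp add: nn_integral_cmult[symmetric] mult.assoc)
  also have "\<dots> \<le> ennreal (2 ^ DIM('a)) * emeasure lborel \<Omega> * (\<integral>\<^sup>+x. ennreal ((d * norm (G x)) powr q) \<partial>lborel)"
    by (rule double_integral_difference_le[OF V_int G_int \<Omega>(1,3) \<open>1 < q\<close> dist_le weak])
  also have "(\<integral>\<^sup>+x. ennreal ((d * norm (G x)) powr q) \<partial>lborel) =
      ennreal (d powr q * (\<integral>x. norm (G x) powr q \<partial>lborel))"
    using \<open>d \<ge> 0\<close> Gq(1) by (subst nn_integral_eq_integral) (auto simp: powr_mult)
  finally have "emeasure lborel \<Omega> * ennreal I \<le>
      emeasure lborel \<Omega> * ennreal (2 ^ DIM('a) * (d powr q * (\<integral>x. norm (G x) powr q \<partial>lborel)))"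
    by (simp add: ennreal_mult' mult_ac)
  \<comment> \<open>Cancelling in \<open>ennreal\<close> needs a factor that is neither 0 nor
    infinite: \<open>\<Omega>\<close> is nonempty and open, and it is bounded.\<close>
  moreover have "emeasure lborel \<Omega> \<noteq> 0"
    using \<Omega> open_not_negligible[of \<Omega>]
    by (simp add: negligible_iff_null_sets null_sets_completion_iff null_sets_def)
  moreover have "emeasure lborel \<Omega> < \<infinity>"
    using emeasure_bounded_finite[OF \<open>bounded \<Omega>\<close>] by simp
  ultimately have "ennreal I \<le> ennreal (2 ^ DIM('a) * (d powr q * (\<integral>x. norm (G x) powr q \<partial>lborel)))"
    by (simp add: ennreal_mult_le_mult_iff)
  then have "I \<le> 2 ^ DIM('a) * (d powr q * (\<integral>x. norm (G x) powr q \<partial>lborel))"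
    by (subst (asm) ennreal_le_iff) auto
  then show ?thesis by (simp add: I_def Gq(2) mult.assoc)
qed

section \<open>The lower bound for \<open>mu\<close> and its limit\<close>

text \<open>The Poincare inequality gives \<open>B \<le> K * C\<close> at exponent \<open>q\<close>,
  and Jensen's inequality with exponent \<open>p / q\<close> compares \<open>C\<close> with
  \<open>A\<close>. The second step is the sole source of the positive power of the volume.\<close>

lemma mu_lower_bound:
  fixes \<Omega> :: "'a::euclidean_space set"
  assumes \<Omega>: "open \<Omega>" "bounded \<Omega>" "convex \<Omega>" "\<Omega> \<noteq> {}" and pq: "1 < q" "q < p" and d: "diameter \<Omega> \<le> d"
  shows "ereal (1 / ((2 ^ DIM('a) * d powr q) powr (p / q) * measure lebesgue \<Omega> powr (p / q - 1)))
    \<le> mu p q \<Omega>"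
  unfolding mu_def
proof (rule Inf_greatest, safe, unfold ereal_less_eq)
  fix v :: "'a \<Rightarrow> real" and g :: "'a \<Rightarrow> 'a"
  assume v: "v \<in> W1p p \<Omega>" and nonzero: "\<not> (AE x in lebesgue_on \<Omega>. v x = 0)"
    and g: "g \<in> Lp p \<Omega>" and vg: "has_weak_gradient \<Omega> v g"
    and mean: "(LINT x|lebesgue_on \<Omega>. \<bar>v x\<bar> powr (q - 2) * v x) = 0"
  interpret \<Omega>: finite_measure "lebesgue_on \<Omega>"
    using \<Omega> by (intro finite_measure_lebesgue_on_bounded)
  define A B C K m where "A = (LINT x|lebesgue_on \<Omega>. norm (g x) powr p)"
    and "B = (LINT x|lebesgue_on \<Omega>. \<bar>v x\<bar> powr q)" and "C = (LINT x|lebesgue_on \<Omega>. norm (g x) powr q)"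
    and "K = 2 ^ DIM('a) * d powr q" and "m = measure lebesgue \<Omega>"
  have v': "v \<in> Lp p \<Omega>" using v by (simp add: W1p_def)
  have [measurable]: "v \<in> borel_measurable (lebesgue_on \<Omega>)" "g \<in> borel_measurable (lebesgue_on \<Omega>)"
    using v' g by (auto simp: Lp_def)
  have "B \<le> K * C"
    unfolding B_def K_def C_def
    by (rule poincare_convex[OF \<Omega> pq(1) less_imp_le[OF pq(2)] d v' g vg mean])
  \<comment> \<open>Since \<open>v\<close> is not almost everywhere 0, the quotient in
    \<open>mu\<close> is a genuine one and not a division by 0.\<close>
  have "B > 0"
  proof -
    have "integrable (lebesgue_on \<Omega>) (\<lambda>x. \<bar>v x\<bar> powr q)"
      using v' pq by (intro \<Omega>.integrable_powr_mono[of v p q]) (auto simp: Lp_def)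
    then have "B \<noteq> 0"
      using nonzero unfolding B_def by (subst integral_nonneg_eq_0_iff_AE) auto
    moreover have "B \<ge> 0" unfolding B_def by simp
    ultimately show ?thesis by simp
  qed
  have "C powr (p / q) \<le> m powr (p / q - 1) * A"
  proof -
    have "integrable (lebesgue_on \<Omega>) (\<lambda>x. norm (g x) powr q)"
      using g pq \<Omega>.integrable_powr_mono[of "\<lambda>x. norm (g x)" p q] by (auto simp: Lp_def)
    moreover have "measure (lebesgue_on \<Omega>) \<Omega> = m"
      using \<Omega>(1) by (simp add: m_def measure_restrict_space)
    ultimately show ?thesis
      using \<Omega>.powr_integral_le[of "\<lambda>x. norm (g x) powr q" "p / q"] g pq \<Omega>(1)
      by (simp add: C_def A_def Lp_def powr_powr)
  qed
  have "B powr (p / q) \<le> (K * C) powr (p / q)"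
    using \<open>B \<le> K * C\<close> \<open>B > 0\<close> pq by (intro powr_mono2) auto
  also have "\<dots> = K powr (p / q) * C powr (p / q)"
    by (rule powr_mult)
  also have "\<dots> \<le> K powr (p / q) * (m powr (p / q - 1) * A)"
    using \<open>C powr (p / q) \<le> _\<close> by (intro mult_left_mono) auto
  finally have le: "B powr (p / q) \<le> K powr (p / q) * m powr (p / q - 1) * A"
    by (simp add: mult.assoc)
  have "B powr (p / q) > 0" using \<open>B > 0\<close> by simp
  have "0 \<le> K powr (p / q) * m powr (p / q - 1)" by simp
  \<comment> \<open>If the constant were 0, the estimate \<open>le\<close> would force the positive
    number \<open>B powr (p / q)\<close> to be at most 0.\<close>
  moreover have "K powr (p / q) * m powr (p / q - 1) \<noteq> 0"
    using le \<open>B powr (p / q) > 0\<close> by auto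
  ultimately have "K powr (p / q) * m powr (p / q - 1) > 0" by linarith
  then show "1 / (K powr (p / q) * m powr (p / q - 1)) \<le> A / B powr (p / q)"
    using le \<open>B powr (p / q) > 0\<close> by (simp add: divide_le_eq le_divide_eq mult.commute)
qed

text \<open>The exponent \<open>p / q - 1\<close> is positive, so the denominator of the lower bound
  tends to 0. A common upper bound \<open>d\<close> on the diameters serves both families of fixed
  diameter and the boxes below, whose diameters vary.\<close>

lemma mu_tendsto_infinity:
  fixes \<Omega> :: "nat \<Rightarrow> 'a::euclidean_space set"
  assumes \<Omega>: "\<And>k. open (\<Omega> k)" "\<And>k. bounded (\<Omega> k)" "\<And>k. convex (\<Omega> k)" "\<And>k. \<Omega> k \<noteq> {}"
    and pq: "1 < q" "q < p" and d: "\<And>k. diameter (\<Omega> k) \<le> d" "0 < d"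
    and lim: "(\<lambda>k. measure lebesgue (\<Omega> k)) \<longlonglongrightarrow> 0"
  shows "(\<lambda>k. mu p q (\<Omega> k)) \<longlonglongrightarrow> \<infinity>"
proof -
  define K where "K = (2 ^ DIM('a) * d powr q) powr (p / q)"
  have "K > 0" using d by (simp add: K_def)
  \<comment> \<open>Positivity matters: at measure 0 the reciprocal would take the default value 0
    instead of being large.\<close>
  have pos: "measure lebesgue (\<Omega> k) > 0" for k
    using \<Omega> open_not_negligible[of "\<Omega> k"]
    by (simp add: zero_less_measure_iff negligible_iff_measure lmeasurable_open)
  have "(\<lambda>k. measure lebesgue (\<Omega> k) powr (p / q - 1)) \<longlonglongrightarrow> 0"
    by (rule tendsto_zero_powrI[OF lim tendsto_const]) (use pq in auto)
  then have "(\<lambda>k. K * measure lebesgue (\<Omega> k) powr (p / q - 1)) \<longlonglongrightarrow> 0"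
    by (rule tendsto_mult_right_zero)
  moreover have "0 < K * measure lebesgue (\<Omega> k) powr (p / q - 1)" for k
    using \<open>K > 0\<close> pos[of k] by simp
  ultimately have "filterlim (\<lambda>k. inverse (K * measure lebesgue (\<Omega> k) powr (p / q - 1))) at_top sequentially"
    by (intro filterlim_inverse_at_top always_eventually) auto
  then have "(\<lambda>k. ereal (1 / (K * measure lebesgue (\<Omega> k) powr (p / q - 1)))) \<longlonglongrightarrow> \<infinity>"
    by (simp add: tendsto_PInfty_eq_at_top inverse_eq_divide)
  moreover have "ereal (1 / (K * measure lebesgue (\<Omega> k) powr (p / q - 1))) \<le> mu p q (\<Omega> k)" for k
    unfolding K_def by (rule mu_lower_bound[OF \<Omega> pq d(1)])
  ultimately show ?thesis
    unfolding tendsto_PInfty by (meson eventually_mono less_le_trans)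
qed

section \<open>Thin boxes and the supremum\<close>

text \<open>One side keeps length \<open>c\<close> while the others shrink like
  \<open>1 / (k + 1)\<close>. The diameter is the length of the diagonal, hence between
  \<open>c\<close> and its value at \<open>k = 0\<close>; the volume tends to 0 because at least one
  side shrinks.\<close>

lemma thin_boxes:
  fixes c :: real
  assumes "2 \<le> CARD('n::finite)" and "0 < c"
  obtains B :: "nat \<Rightarrow> (real ^ 'n) set" and d where
    "\<And>k. open (B k)" "\<And>k. bounded (B k)" "\<And>k. convex (B k)" "\<And>k. B k \<noteq> {}"
    "\<And>k. c \<le> diameter (B k)" "\<And>k. diameter (B k) \<le> d" "(\<lambda>k. measure lebesgue (B k)) \<longlonglongrightarrow> 0"
proof -
  fix j :: 'n
  define b :: "nat \<Rightarrow> real ^ 'n" where "b k = (\<chi> i. if i = j then c else inverse (real (Suc k)))" for k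
  have b_pos: "0 < b k $ i" for k i using \<open>0 < c\<close> by (simp add: b_def)
  have nonempty: "box 0 (b k) \<noteq> {}" for k
    using b_pos by (simp add: box_ne_empty Basis_vec_def inner_axis)
  have diam: "diameter (box 0 (b k)) = norm (b k)" for k
  proof -
    have "diameter (box 0 (b k)) = diameter (cbox 0 (b k))"
      using nonempty diameter_closure[of "box 0 (b k)"] by (simp add: closure_box)
    also have "\<dots> = dist 0 (b k)"
      using b_pos by (intro diameter_cbox) (auto simp: Basis_vec_def inner_axis less_imp_le)
    finally show ?thesis by simp
  qed
  have meas: "measure lebesgue (box 0 (b k)) \<le> c * inverse (real (Suc k))" for k
  proof -
    have "measure lebesgue (box 0 (b k)) = measure lborel (cbox 0 (b k))"
      by (simp add: measure_lborel_box_eq measure_lborel_cbox_eq)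
    also have "\<dots> = (\<Prod>i\<in>UNIV. b k $ i)"
      using b_pos by (subst content_cbox_cart) (auto simp: interval_ne_empty_cart less_imp_le)
    also have "\<dots> = c * (\<Prod>i\<in>UNIV - {j}. inverse (real (Suc k)))"
      by (subst prod.remove[of _ j]) (auto simp: b_def intro!: prod.cong)
    also have "\<dots> = c * inverse (real (Suc k)) ^ (CARD('n) - 1)"
      by (simp add: card_Diff_singleton)
    \<comment> \<open>In dimension at least 2 the exponent is at least 1, and the base is at most
      1.\<close>
    also have "\<dots> \<le> c * inverse (real (Suc k)) ^ 1"
      using assms by (intro mult_left_mono power_decreasing) (auto simp: inverse_le_1_iff)
    finally show ?thesis by simp
  qed
  show ?thesis
  proof (rule that[of "\<lambda>k. box 0 (b k)" "norm (b 0)"])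
    fix k
    show "c \<le> diameter (box 0 (b k))"
      unfolding diam using component_le_norm_cart[of "b k" j] \<open>0 < c\<close> by (simp add: b_def)
    show "diameter (box 0 (b k)) \<le> norm (b 0)"
      unfolding diam using \<open>0 < c\<close>
      by (intro norm_le_componentwise_cart) (auto simp: b_def inverse_le_1_iff)
  next
    have "(\<lambda>k. c * inverse (real (Suc k))) \<longlonglongrightarrow> c * 0"
      by (intro tendsto_intros LIMSEQ_inverse_real_of_nat)
    then have "(\<lambda>k. c * inverse (real (Suc k))) \<longlonglongrightarrow> 0" by simp
    then show "(\<lambda>k. measure lebesgue (box 0 (b k))) \<longlonglongrightarrow> 0"
      by (rule tendsto_sandwich[OF _ _ tendsto_const, rotated -1]) (use meas in auto)
  qed (use nonempty in auto)
qed

text \<open>The dimension restriction on the supremum reflects that in dimension one the sets are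
  intervals whose measure equals their diameter, so their measures cannot tend to 0.\<close>

theorem mainTheorem7:
  fixes p q c :: real
  assumes "1 < q" and "q < p" and "0 < c"
  shows "(2 \<le> CARD('n) \<longrightarrow>
            (SUP \<Omega> \<in> {\<Omega> :: (real ^ 'n) set.
                 open \<Omega> \<and> bounded \<Omega> \<and> convex \<Omega> \<and> c \<le> diameter \<Omega>}. mu p q \<Omega>) = \<infinity>) \<and>
         (\<forall>\<Omega> :: nat \<Rightarrow> (real ^ 'n) set.
            (\<forall>k. open (\<Omega> k) \<and> bounded (\<Omega> k) \<and> convex (\<Omega> k) \<and> diameter (\<Omega> k) = c) \<longrightarrow>
            (\<lambda>k. measure lebesgue (\<Omega> k)) \<longlonglongrightarrow> 0 \<longrightarrow>
            (\<lambda>k. mu p q (\<Omega> k)) \<longlonglongrightarrow> \<infinity>)"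
proof (intro conjI impI allI)
  let ?S = "{\<Omega> :: (real ^ 'n) set. open \<Omega> \<and> bounded \<Omega> \<and> convex \<Omega> \<and> c \<le> diameter \<Omega>}"
  assume "2 \<le> CARD('n)"
  from thin_boxes[OF this \<open>0 < c\<close>] obtain B :: "nat \<Rightarrow> (real ^ 'n) set" and d where
    B: "\<And>k. open (B k)" "\<And>k. bounded (B k)" "\<And>k. convex (B k)" "\<And>k. B k \<noteq> {}"
    and diam: "\<And>k. c \<le> diameter (B k)" "\<And>k. diameter (B k) \<le> d"
    and lim: "(\<lambda>k. measure lebesgue (B k)) \<longlonglongrightarrow> 0"
    by blast
  have "0 < d" using diam[of 0] \<open>0 < c\<close> by linarith
  have "(\<lambda>k. mu p q (B k)) \<longlonglongrightarrow> \<infinity>"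
    by (rule mu_tendsto_infinity[OF B assms(1,2) diam(2) \<open>0 < d\<close> lim])
  moreover have "mu p q (B k) \<le> (SUP \<Omega> \<in> ?S. mu p q \<Omega>)" for k
    using B diam by (intro SUP_upper) auto
  ultimately have "\<infinity> \<le> (SUP \<Omega> \<in> ?S. mu p q \<Omega>)"
    by (intro LIMSEQ_le_const2) auto
  then show "(SUP \<Omega> \<in> ?S. mu p q \<Omega>) = \<infinity>" by simp
next
  fix \<Omega> :: "nat \<Rightarrow> (real ^ 'n) set"
  assume \<Omega>: "\<forall>k. open (\<Omega> k) \<and> bounded (\<Omega> k) \<and> convex (\<Omega> k) \<and> diameter (\<Omega> k) = c"
    and lim: "(\<lambda>k. measure lebesgue (\<Omega> k)) \<longlonglongrightarrow> 0"
  \<comment> \<open>The empty set has diameter 0 by convention, so \<open>0 < c\<close> excludes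
    it.\<close>
  have "\<Omega> k \<noteq> {}" for k
    using \<Omega> \<open>0 < c\<close> by (metis diameter_empty less_irrefl)
  then show "(\<lambda>k. mu p q (\<Omega> k)) \<longlonglongrightarrow> \<infinity>"
    using \<Omega> assms lim by (intro mu_tendsto_infinity[where d=c]) auto
qed

end
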